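(* Let $0<\tau\le T$ and let $W$ be a classical real Brownian motion on $[0,T]$. Then the $C([-\tau,0])$-valued window process $W(\cdot)$ does not admit a scalar quadratic variation. In particular $W(\cdot)$ does not admit a global quadratic variation.
   Context: Fix $T>0$ and a probability space $(\Omega,\mathcal F,\mathbb P)$. Processes on $[0,T]$ are extended by $X_t=X_0$ for $t\le0$ and $X_t=X_T$ for $t\ge T$. The window process of $W$ is $W(\cdot)=(W_t(\cdot))_{t\in[0,T]}$ with $W_t(x)=W_{t+x}$, $x\in[-\tau,0]$, with values in $B=C([-\tau,0])$ (sup norm). $\mathscr C([0,T])$ is the space of real continuous processes with the topology of uniform convergence in probability (ucp) on $[0,T]$. A $B$-valued process $\mathbb X$ admits a scalar quadratic variation if $\int_0^\cdot\epsilon^{-1}\|\mathbb X_{s+\epsilon}-\mathbb X_s\|_B^2ds$ converges ucp as $\epsilon\downarrow0$. With $\chi=(B\hat\otimes_\pi B)^*$ (dual of the projective tensor product), $\mathbb X$ admits a global quadratic variation if (H1) every sequence $\epsilon_n\downarrow0$ has a subsequence $(\epsilon_{n_k})$ with $\sup_k\int_0^T\epsilon_{n_k}^{-1}\|(\mathbb X_{s+\epsilon_{n_k}}-\mathbb X_s)\otimes(\mathbb X_{s+\epsilon_{n_k}}-\mathbb X_s)\|_{\chi^*}ds<\infty$ a.s.; (H2)(i) there is a map $[\mathbb X]:\chi\to\mathscr C([0,T])$ such that $\int_0^\cdot\langle\phi,\epsilon^{-1}(\mathbb X_{s+\epsilon}-\mathbb X_s)\otimes(\mathbb X_{s+\epsilon}-\mathbb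 X_s)\rangle ds\to[\mathbb X](\phi)$ ucp as $\epsilon\to0+$ for every $\phi\in\chi$; (H2)(ii) there is a measurable process $\widetilde{[\mathbb X]}:\Omega\times[0,T]\to\chi^*$ with a.s. (càdlàg) bounded variation paths and $\widetilde{[\mathbb X]}(\cdot,t)(\phi)=[\mathbb X](\phi)(\cdot,t)$ a.s. for all $\phi\in\chi$, $t\in[0,T]$. *)

theory Defs
  imports "HOL-Probability.Probability"
begin

text \<open>
  The spaces below depend on the real parameter \<open>\<tau>\<close>, so they cannot be types. All of them,
  \<open>C([-\<tau>,0])\<close>, its tensor square and the iterated duals, consist of real-valued functions with
  pointwise operations; a normed space is therefore given by a carrier inside a function type
  \<open>'i \<Rightarrow> real\<close> together with its norm. Functions with a restricted domain are set to \<open>0\<close>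
  outside it, which makes pointwise equality the equality of the space.
\<close>

record 'i fspace =
  pts :: "('i \<Rightarrow> real) set"
  nrm :: "('i \<Rightarrow> real) \<Rightarrow> real"

definition fdist :: "'i fspace \<Rightarrow> ('i \<Rightarrow> real) \<Rightarrow> ('i \<Rightarrow> real) \<Rightarrow> real" where
  "fdist E u v = (if u \<in> pts E \<and> v \<in> pts E then nrm E (\<lambda>i. u i - v i) else 0)"

definition ftop :: "'i fspace \<Rightarrow> ('i \<Rightarrow> real) topology" where
  "ftop E = Metric_space.mtopology (pts E) (fdist E)"

definition fborel :: "'i fspace \<Rightarrow> ('i \<Rightarrow> real) measure" where
  "fborel E = sigma (pts E) {U. openin (ftop E) U}"

definition C_space :: "real \<Rightarrow> real \<Rightarrow> real fspace" where
  "C_space a b =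
     \<lparr> pts = {f. continuous_on {a..b} f \<and> (\<forall>x. x \<notin> {a..b} \<longrightarrow> f x = 0)},
       nrm = (\<lambda>f. SUP x\<in>{a..b}. \<bar>f x\<bar>) \<rparr>"

definition dual :: "'i fspace \<Rightarrow> ('i \<Rightarrow> real) fspace" where
  "dual E =
     \<lparr> pts = {\<phi>. (\<forall>u\<in>pts E. \<forall>v\<in>pts E. \<forall>a b. \<phi> (\<lambda>i. a * u i + b * v i) = a * \<phi> u + b * \<phi> v)
                \<and> (\<exists>K. \<forall>u\<in>pts E. \<bar>\<phi> u\<bar> \<le> K * nrm E u)
                \<and> (\<forall>u. u \<notin> pts E \<longrightarrow> \<phi> u = 0)},
       nrm = (\<lambda>\<phi>. SUP u\<in>{u \<in> pts E. nrm E u \<le> 1}. \<bar>\<phi> u\<bar>) \<rparr>"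

definition eval_embed :: "'i fspace \<Rightarrow> ('i \<Rightarrow> real) \<Rightarrow> (('i \<Rightarrow> real) \<Rightarrow> real) \<Rightarrow> real" where
  "eval_embed E u = (\<lambda>\<phi>. if \<phi> \<in> pts (dual E) then \<phi> u else 0)"

text \<open>
  The Banach completion, realised as the closure of the canonical isometric image in the bidual.
\<close>

definition completion :: "'i fspace \<Rightarrow> (('i \<Rightarrow> real) \<Rightarrow> real) fspace" where
  "completion E =
     \<lparr> pts = ftop (dual (dual E)) closure_of (eval_embed E ` pts E),
       nrm = nrm (dual (dual E)) \<rparr>"

text \<open>
  The algebraic tensor product is the span of the elementary tensors, where \<open>x \<otimes> y\<close> is the
  functional \<open>b \<mapsto> b x y\<close> on the space of all (not necessarily bounded) bilinear forms.
\<close>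

type_synonym ('i, 'j) bil = "('i \<Rightarrow> real) \<Rightarrow> ('j \<Rightarrow> real) \<Rightarrow> real"

definition bilinear_forms ::
    "'i fspace \<Rightarrow> 'j fspace \<Rightarrow> ('i, 'j) bil set" where
  "bilinear_forms E F =
     {b. (\<forall>u\<in>pts E. \<forall>v\<in>pts E. \<forall>y\<in>pts F. \<forall>c d.
            b (\<lambda>i. c * u i + d * v i) y = c * b u y + d * b v y)
       \<and> (\<forall>x\<in>pts E. \<forall>u\<in>pts F. \<forall>v\<in>pts F. \<forall>c d.
            b x (\<lambda>j. c * u j + d * v j) = c * b x u + d * b x v)}"

definition alg_tensor ::
    "'i fspace \<Rightarrow> 'j fspace \<Rightarrow> ('i \<Rightarrow> real) \<Rightarrow> ('j \<Rightarrow> real) \<Rightarrow> ('i, 'j) bil \<Rightarrow> real" where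
  "alg_tensor E F x y = (\<lambda>b. if b \<in> bilinear_forms E F then b x y else 0)"

definition tensor_reps ::
    "'i fspace \<Rightarrow> 'j fspace \<Rightarrow> (('i, 'j) bil \<Rightarrow> real) \<Rightarrow>
     (('i \<Rightarrow> real) \<times> ('j \<Rightarrow> real)) list set" where
  "tensor_reps E F u =
     {xys. set xys \<subseteq> pts E \<times> pts F \<and> u = (\<lambda>b. \<Sum>(x, y)\<leftarrow>xys. alg_tensor E F x y b)}"

definition pi_tensor :: "'i fspace \<Rightarrow> 'j fspace \<Rightarrow> ('i, 'j) bil fspace" where
  "pi_tensor E F =
     \<lparr> pts = {u. tensor_reps E F u \<noteq> {}},
       nrm = (\<lambda>u. INF xys\<in>tensor_reps E F u. \<Sum>(x, y)\<leftarrow>xys. nrm E x * nrm F y) \<rparr>"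

definition proj_tensor ::
    "'i fspace \<Rightarrow> 'j fspace \<Rightarrow> ((('i, 'j) bil \<Rightarrow> real) \<Rightarrow> real) fspace" where
  "proj_tensor E F = completion (pi_tensor E F)"

definition tens ::
    "'i fspace \<Rightarrow> 'j fspace \<Rightarrow> ('i \<Rightarrow> real) \<Rightarrow> ('j \<Rightarrow> real) \<Rightarrow>
     ((('i, 'j) bil \<Rightarrow> real) \<Rightarrow> real) \<Rightarrow> real" where
  "tens E F x y = eval_embed (pi_tensor E F) (alg_tensor E F x y)"

text \<open>Processes take the time as first argument; only their values on \<open>[0,T]\<close> are used.\<close>

definition ext_time :: "real \<Rightarrow> (real \<Rightarrow> 'w \<Rightarrow> 'c) \<Rightarrow> real \<Rightarrow> 'w \<Rightarrow> 'c" where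
  "ext_time T X t = X (max 0 (min T t))"

definition window ::
    "real \<Rightarrow> real \<Rightarrow> (real \<Rightarrow> 'w \<Rightarrow> real) \<Rightarrow> real \<Rightarrow> 'w \<Rightarrow> real \<Rightarrow> real" where
  "window T \<tau> W t \<omega> = (\<lambda>x. if x \<in> {-\<tau>..0} then ext_time T W (t + x) \<omega> else 0)"

definition incr ::
    "real \<Rightarrow> (real \<Rightarrow> 'w \<Rightarrow> 'i \<Rightarrow> real) \<Rightarrow> real \<Rightarrow> real \<Rightarrow> 'w \<Rightarrow> 'i \<Rightarrow> real" where
  "incr T X \<epsilon> s \<omega> = (\<lambda>i. ext_time T X (s + \<epsilon>) \<omega> i - ext_time T X s \<omega> i)"

definition brownian_motion :: "'w measure \<Rightarrow> real \<Rightarrow> (real \<Rightarrow> 'w \<Rightarrow> real) \<Rightarrow> bool" where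
  "brownian_motion M T W \<longleftrightarrow>
     prob_space M
     \<and> (\<forall>t\<in>{0..T}. W t \<in> borel_measurable M)
     \<and> (\<forall>\<omega>\<in>space M. continuous_on {0..T} (\<lambda>t. W t \<omega>))
     \<and> (AE \<omega> in M. W 0 \<omega> = 0)
     \<and> (\<forall>s t. 0 \<le> s \<and> s < t \<and> t \<le> T \<longrightarrow>
          distributed M lborel (\<lambda>\<omega>. W t \<omega> - W s \<omega>)
            (\<lambda>x. ennreal (normal_density 0 (sqrt (t - s)) x)))
     \<and> (\<forall>(n::nat) t. (\<forall>i\<le>n. t i \<in> {0..T}) \<and> (\<forall>i<n. t i < t (Suc i)) \<longrightarrow>
          prob_space.indep_vars M (\<lambda>_. borel) (\<lambda>i \<omega>. W (t (Suc i)) \<omega> - W (t i) \<omega>) {..<n})"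

definition cont_procs :: "'w measure \<Rightarrow> real \<Rightarrow> (real \<Rightarrow> 'w \<Rightarrow> real) set" where
  "cont_procs M T =
     {Z. (\<forall>t\<in>{0..T}. Z t \<in> borel_measurable M)
       \<and> (\<forall>\<omega>\<in>space M. continuous_on {0..T} (\<lambda>t. Z t \<omega>))}"

text \<open>
  The membership conditions make the events below measurable. They cannot be dropped:
  \<open>measure\<close> is \<open>0\<close> on sets that are not measurable.
\<close>

definition ucp_limit ::
    "'w measure \<Rightarrow> real \<Rightarrow> (real \<Rightarrow> real \<Rightarrow> 'w \<Rightarrow> real) \<Rightarrow> (real \<Rightarrow> 'w \<Rightarrow> real) \<Rightarrow> bool" where
  "ucp_limit M T Y Z \<longleftrightarrow>
     (\<forall>\<^sub>F \<epsilon> in at_right 0. Y \<epsilon> \<in> cont_procs M T) \<and> Z \<in> cont_procs M T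
     \<and> (\<forall>\<delta>>0. ((\<lambda>\<epsilon>. measure M {\<omega> \<in> space M. (SUP t\<in>{0..T}. \<bar>Y \<epsilon> t \<omega> - Z t \<omega>\<bar>) > \<delta>})
                  \<longlongrightarrow> 0) (at_right 0))"

definition admits_scalar_qv ::
    "'w measure \<Rightarrow> real \<Rightarrow> 'i fspace \<Rightarrow> (real \<Rightarrow> 'w \<Rightarrow> 'i \<Rightarrow> real) \<Rightarrow> bool" where
  "admits_scalar_qv M T B X \<longleftrightarrow>
     (\<exists>Z. ucp_limit M T (\<lambda>\<epsilon> t \<omega>. LINT s:{0..t}|lborel. (nrm B (incr T X \<epsilon> s \<omega>))\<^sup>2 / \<epsilon>) Z)"

definition bounded_variation :: "'i fspace \<Rightarrow> real \<Rightarrow> (real \<Rightarrow> 'i \<Rightarrow> real) \<Rightarrow> bool" where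
  "bounded_variation E T f \<longleftrightarrow>
     (\<exists>K. \<forall>(n::nat) t. (\<forall>i\<le>n. t i \<in> {0..T}) \<and> (\<forall>i<n. t i \<le> t (Suc i)) \<longrightarrow>
        (\<Sum>i<n. fdist E (f (t (Suc i))) (f (t i))) \<le> K)"

definition cadlag :: "'i fspace \<Rightarrow> real \<Rightarrow> (real \<Rightarrow> 'i \<Rightarrow> real) \<Rightarrow> bool" where
  "cadlag E T f \<longleftrightarrow>
     (\<forall>t\<in>{0..<T}. limitin (ftop E) f (f t) (at_right t))
     \<and> (\<forall>t\<in>{0<..T}. \<exists>l. limitin (ftop E) f l (at_left t))"

text \<open>
  In \<open>H1\<close>, an element of \<open>proj_tensor B B\<close> is regarded as an element of the bidual
  through \<open>eval_embed\<close>.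
\<close>

definition global_qv_H1 ::
    "'w measure \<Rightarrow> real \<Rightarrow> 'i fspace \<Rightarrow> (real \<Rightarrow> 'w \<Rightarrow> 'i \<Rightarrow> real) \<Rightarrow> bool" where
  "global_qv_H1 M T B X \<longleftrightarrow>
     (\<forall>\<epsilon>::nat \<Rightarrow> real. (\<forall>n. \<epsilon> n > 0) \<and> decseq \<epsilon> \<and> \<epsilon> \<longlonglongrightarrow> 0 \<longrightarrow>
       (\<exists>r::nat \<Rightarrow> nat. strict_mono r \<and>
         (AE \<omega> in M.
           (SUP k. \<integral>\<^sup>+ s\<in>{0..T}.
              ennreal (nrm (dual (dual (proj_tensor B B)))
                (eval_embed (proj_tensor B B)
                  (tens B B (incr T X (\<epsilon> (r k)) s \<omega>) (incr T X (\<epsilon> (r k)) s \<omega>))) / \<epsilon> (r k))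
              \<partial>lborel) < \<infinity>)))"

definition global_qv_H2 ::
    "'w measure \<Rightarrow> real \<Rightarrow> 'i fspace \<Rightarrow> (real \<Rightarrow> 'w \<Rightarrow> 'i \<Rightarrow> real) \<Rightarrow> bool" where
  "global_qv_H2 M T B X \<longleftrightarrow>
     (let Chi = dual (proj_tensor B B) in
      \<exists>Q. (\<forall>\<phi>\<in>pts Chi.
             ucp_limit M T
               (\<lambda>\<epsilon> t \<omega>. LINT s:{0..t}|lborel.
                  \<phi> (\<lambda>i. tens B B (incr T X \<epsilon> s \<omega>) (incr T X \<epsilon> s \<omega>) i / \<epsilon>))
               (Q \<phi>))
        \<and> (\<exists>R. (\<lambda>(\<omega>, t). R \<omega> t) \<in>
                   measurable (M \<Otimes>\<^sub>M restrict_space borel {0..T}) (fborel (dual Chi))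
             \<and> (AE \<omega> in M. cadlag (dual Chi) T (R \<omega>) \<and> bounded_variation (dual Chi) T (R \<omega>))
             \<and> (\<forall>\<phi>\<in>pts Chi. \<forall>t\<in>{0..T}. AE \<omega> in M. R \<omega> t \<phi> = Q \<phi> t \<omega>)))"

definition admits_global_qv ::
    "'w measure \<Rightarrow> real \<Rightarrow> 'i fspace \<Rightarrow> (real \<Rightarrow> 'w \<Rightarrow> 'i \<Rightarrow> real) \<Rightarrow> bool" where
  "admits_global_qv M T B X \<longleftrightarrow> global_qv_H1 M T B X \<and> global_qv_H2 M T B X"

end

theory Submission
  imports Defs
begin

text \<open>
  Write \<open>X\<close> for the window process and let \<open>\<epsilon>\<close> be small. For every \<open>s\<close> between \<open>\<tau>/2\<close> and
  \<open>\<tau> - \<epsilon>\<close> the path piece \<open>X\<^sub>s\<close> covers the fixed time interval \<open>[0, \<tau>/2]\<close>, so the sup norm of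
  \<open>X\<^sub>s\<^sub>+\<^sub>\<epsilon> - X\<^sub>s\<close> is at least \<open>\<bar>W\<^sub>u\<^sub>+\<^sub>\<epsilon> - W\<^sub>u\<bar>\<close> for every \<open>u\<close> in \<open>[0, \<tau>/2]\<close>
  (\<open>incr_window_contains_increment\<close>). This bound does not depend on \<open>s\<close>. Hence the approximate
  quadratic variation at time \<open>T\<close> is at least \<open>\<tau>/4\<close> times the supremum over \<open>u\<close> of
  \<open>(W\<^sub>u\<^sub>+\<^sub>\<epsilon> - W\<^sub>u)\<^sup>2 / \<epsilon>\<close>, for every single path.

  That supremum tends to infinity in probability as \<open>\<epsilon>\<close> tends to 0. For a fixed number \<open>N\<close> and
  small \<open>\<epsilon>\<close> it dominates the maximum of \<open>N\<close> independent squared standard normal variables, which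
  stays below \<open>K\<close> with probability \<open>p ^ N\<close>, where \<open>p < 1\<close> depends on \<open>K\<close> only; and \<open>N\<close> is
  arbitrary (\<open>brownian_increments_blow_up\<close>).

  For the scalar quadratic variation, a ucp limit would be finite at time \<open>T\<close>, hence bounded by
  some \<open>C\<close> up to a small probability, and so would the approximations
  (\<open>window_not_scalar_qv\<close>). For the global quadratic variation it is condition H1 that fails
  (\<open>window_not_global_qv_H1\<close>): along every subsequence the integrals are almost surely unbounded.
  This needs the lower half of the cross-norm identity, namely that the norm of \<open>u \<otimes> u\<close> in
  the bidual of the projective tensor square is at least \<open>u(x)\<^sup>2\<close> for each point \<open>x\<close>
  (\<open>nrm_tens_C_space_ge\<close>). It is proved by testing \<open>u \<otimes> u\<close> against the functional induced by
  the bilinear form \<open>(f, g) \<mapsto> f(x) g(x)\<close>, which has norm at most one.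
\<close>

section \<open>Seminormed spaces of real functions\<close>

text \<open>
  Seminorms rather than norms, because definiteness of the projective norm on the algebraic
  tensor product would require a Hahn--Banach argument, whereas dual norms are definite whatever
  the space (\<open>dual_definite\<close>). The distance that defines the completion is therefore a metric.
\<close>
locale seminormed_fspace =
  fixes E :: "'i fspace"
  assumes zero_mem: "(\<lambda>i. 0) \<in> pts E"
    and lincomb_mem: "\<And>u v a b. u \<in> pts E \<Longrightarrow> v \<in> pts E \<Longrightarrow> (\<lambda>i. a * u i + b * v i) \<in> pts E"
    and nrm_nonneg: "\<And>u. u \<in> pts E \<Longrightarrow> 0 \<le> nrm E u"
    and nrm_scale: "\<And>u c. u \<in> pts E \<Longrightarrow> nrm E (\<lambda>i. c * u i) = \<bar>c\<bar> * nrm E u"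
    and nrm_add: "\<And>u v. u \<in> pts E \<Longrightarrow> v \<in> pts E \<Longrightarrow>
      nrm E (\<lambda>i. u i + v i) \<le> nrm E u + nrm E v"
begin

lemma scale_mem: "u \<in> pts E \<Longrightarrow> (\<lambda>i. c * u i) \<in> pts E"
  using lincomb_mem[of u u c 0] by simp

lemma diff_mem: "u \<in> pts E \<Longrightarrow> v \<in> pts E \<Longrightarrow> (\<lambda>i. u i - v i) \<in> pts E"
  using lincomb_mem[of u v 1 "-1"] by simp

lemma nrm_zero: "nrm E (\<lambda>i. 0) = 0"
  using nrm_scale[OF zero_mem, of 0] by simp

lemma nrm_lincomb:
  assumes "u \<in> pts E" "v \<in> pts E"
  shows "nrm E (\<lambda>i. a * u i + b * v i) \<le> \<bar>a\<bar> * nrm E u + \<bar>b\<bar> * nrm E v"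
  using nrm_add[OF scale_mem scale_mem, of u v a b] nrm_scale assms by simp

lemma dual_lincomb:
  "\<phi> \<in> pts (dual E) \<Longrightarrow> u \<in> pts E \<Longrightarrow> v \<in> pts E \<Longrightarrow>
    \<phi> (\<lambda>i. a * u i + b * v i) = a * \<phi> u + b * \<phi> v"
  by (simp add: dual_def)

lemma dual_scale: "\<phi> \<in> pts (dual E) \<Longrightarrow> u \<in> pts E \<Longrightarrow> \<phi> (\<lambda>i. a * u i) = a * \<phi> u"
  using dual_lincomb[of \<phi> u u a 0] by simp

lemma dual_outside: "\<phi> \<in> pts (dual E) \<Longrightarrow> u \<notin> pts E \<Longrightarrow> \<phi> u = 0"
  by (simp add: dual_def)

lemma dual_boundedE:
  assumes "\<phi> \<in> pts (dual E)"
  obtains K where "\<And>v. v \<in> pts E \<Longrightarrow> \<bar>\<phi> v\<bar> \<le> K * nrm E v"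
  using assms unfolding dual_def by fastforce

text \<open>
  The supremum that defines the dual norm carries information only once it is known to be taken
  over a bounded set.
\<close>
lemma dual_bdd_above:
  assumes \<phi>: "\<phi> \<in> pts (dual E)"
  shows "bdd_above ((\<lambda>w. \<bar>\<phi> w\<bar>) ` {w \<in> pts E. nrm E w \<le> 1})"
proof -
  obtain K where K: "\<And>v. v \<in> pts E \<Longrightarrow> \<bar>\<phi> v\<bar> \<le> K * nrm E v"
    using dual_boundedE[OF \<phi>] by metis
  show ?thesis
  proof (rule bdd_aboveI2)
    fix w assume w: "w \<in> {w \<in> pts E. nrm E w \<le> 1}"
    have "\<bar>\<phi> w\<bar> \<le> K * nrm E w" using K w by simp
    also have "\<dots> \<le> \<bar>K\<bar> * 1"
      using w nrm_nonneg[of w] by (intro mult_mono) auto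
    finally show "\<bar>\<phi> w\<bar> \<le> \<bar>K\<bar>" by simp
  qed
qed

text \<open>
  Vectors of seminorm \<open>0\<close> cannot be rescaled to the unit sphere; on them the functional vanishes
  by its own boundedness.
\<close>
lemma dual_bound:
  assumes \<phi>: "\<phi> \<in> pts (dual E)" and u: "u \<in> pts E"
  shows "\<bar>\<phi> u\<bar> \<le> nrm (dual E) \<phi> * nrm E u"
proof -
  obtain K where K: "\<And>v. v \<in> pts E \<Longrightarrow> \<bar>\<phi> v\<bar> \<le> K * nrm E v"
    using dual_boundedE[OF \<phi>] by metis
  show ?thesis
  proof (cases "nrm E u = 0")
    case True
    then show ?thesis using K[OF u] by simp
  next
    case False
    with nrm_nonneg[OF u] have pos: "0 < nrm E u" by simp
    define v where "v = (\<lambda>i. (1 / nrm E u) * u i)"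
    have v: "v \<in> pts E" "nrm E v = 1"
      using scale_mem[OF u, of "1 / nrm E u"] nrm_scale[OF u, of "1 / nrm E u"] pos
      by (auto simp: v_def)
    have "\<bar>\<phi> v\<bar> \<le> nrm (dual E) \<phi>"
      using v dual_bdd_above[OF \<phi>] by (auto simp: dual_def intro: cSUP_upper2)
    moreover have "\<phi> v = \<phi> u / nrm E u"
      unfolding v_def by (subst dual_scale[OF \<phi> u]) simp
    ultimately show ?thesis
      using pos by (simp add: field_simps)
  qed
qed

lemma dual_memI:
  assumes "\<And>u v a b. u \<in> pts E \<Longrightarrow> v \<in> pts E \<Longrightarrow>
      \<phi> (\<lambda>i. a * u i + b * v i) = a * \<phi> u + b * \<phi> v"
    and "\<And>u. u \<in> pts E \<Longrightarrow> \<bar>\<phi> u\<bar> \<le> c * nrm E u"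
    and "\<And>u. u \<notin> pts E \<Longrightarrow> \<phi> u = 0"
  shows "\<phi> \<in> pts (dual E)"
  using assms unfolding dual_def by simp blast

lemma dual_nrm_le:
  assumes "\<And>u. u \<in> pts E \<Longrightarrow> \<bar>\<phi> u\<bar> \<le> c * nrm E u" and "0 \<le> c"
  shows "nrm (dual E) \<phi> \<le> c"
proof -
  have "(SUP u\<in>{u \<in> pts E. nrm E u \<le> 1}. \<bar>\<phi> u\<bar>) \<le> c"
  proof (rule cSUP_least)
    show "{u \<in> pts E. nrm E u \<le> 1} \<noteq> {}"
      using zero_mem nrm_zero by force
    fix u assume u: "u \<in> {u \<in> pts E. nrm E u \<le> 1}"
    then have "\<bar>\<phi> u\<bar> \<le> c * nrm E u" using assms(1) by simp
    also have "\<dots> \<le> c * 1" using u assms(2) by (intro mult_left_mono) auto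
    finally show "\<bar>\<phi> u\<bar> \<le> c" by simp
  qed
  then show ?thesis by (simp add: dual_def)
qed

lemma dual_nrm_nonneg:
  assumes \<phi>: "\<phi> \<in> pts (dual E)"
  shows "0 \<le> nrm (dual E) \<phi>"
proof -
  have "\<bar>\<phi> (\<lambda>i. 0)\<bar> \<le> nrm (dual E) \<phi>"
    using dual_bdd_above[OF \<phi>] zero_mem nrm_zero by (auto simp: dual_def intro: cSUP_upper2)
  then show ?thesis by simp
qed

text \<open>
  Scaling by \<open>c\<close> enlarges the dual norm by at most the factor \<open>\<bar>c\<bar>\<close>; applying this to
  \<open>1/c\<close> as well turns the estimate into the required equality.
\<close>
lemma seminormed_dual: "seminormed_fspace (dual E)"
proof
  show 0: "(\<lambda>u. 0) \<in> pts (dual E)"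
    by (rule dual_memI[where c = 0]) auto
  have lc: "(\<lambda>u. a * \<phi> u + b * \<psi> u) \<in> pts (dual E)"
    and lcb: "\<And>u. u \<in> pts E \<Longrightarrow> \<bar>a * \<phi> u + b * \<psi> u\<bar>
      \<le> (\<bar>a\<bar> * nrm (dual E) \<phi> + \<bar>b\<bar> * nrm (dual E) \<psi>) * nrm E u"
    if "\<phi> \<in> pts (dual E)" "\<psi> \<in> pts (dual E)" for \<phi> \<psi> a b
  proof -
    show bd: "\<bar>a * \<phi> u + b * \<psi> u\<bar>
      \<le> (\<bar>a\<bar> * nrm (dual E) \<phi> + \<bar>b\<bar> * nrm (dual E) \<psi>) * nrm E u" if u: "u \<in> pts E" for u
    proof -
      have "\<bar>a * \<phi> u + b * \<psi> u\<bar> \<le> \<bar>a\<bar> * \<bar>\<phi> u\<bar> + \<bar>b\<bar> * \<bar>\<psi> u\<bar>"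
        by (metis abs_mult abs_triangle_ineq)
      also have "\<dots> \<le> \<bar>a\<bar> * (nrm (dual E) \<phi> * nrm E u) + \<bar>b\<bar> * (nrm (dual E) \<psi> * nrm E u)"
        using that \<open>\<phi> \<in> _\<close> \<open>\<psi> \<in> _\<close> u by (intro add_mono mult_left_mono dual_bound) auto
      finally show ?thesis by (simp add: algebra_simps)
    qed
    show "(\<lambda>u. a * \<phi> u + b * \<psi> u) \<in> pts (dual E)"
      by (rule dual_memI[OF _ bd]) (use that in \<open>auto simp: dual_lincomb dual_outside algebra_simps\<close>)
  qed
  then show "\<And>u v a b. u \<in> pts (dual E) \<Longrightarrow> v \<in> pts (dual E) \<Longrightarrow>
      (\<lambda>i. a * u i + b * v i) \<in> pts (dual E)" by blast
  show "\<And>u. u \<in> pts (dual E) \<Longrightarrow> 0 \<le> nrm (dual E) u"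
    by (rule dual_nrm_nonneg)
  show "nrm (dual E) (\<lambda>u. \<phi> u + \<psi> u) \<le> nrm (dual E) \<phi> + nrm (dual E) \<psi>"
    if "\<phi> \<in> pts (dual E)" "\<psi> \<in> pts (dual E)" for \<phi> \<psi>
    using lcb[of \<phi> \<psi> _ 1 1] that
    by (intro dual_nrm_le add_nonneg_nonneg dual_nrm_nonneg) auto
  have le: "nrm (dual E) (\<lambda>u. c * \<phi> u) \<le> \<bar>c\<bar> * nrm (dual E) \<phi>"
    if "\<phi> \<in> pts (dual E)" for \<phi> c
    using lcb[of \<phi> \<phi> _ c 0] that
    by (intro dual_nrm_le mult_nonneg_nonneg dual_nrm_nonneg) auto
  show "nrm (dual E) (\<lambda>u. c * \<phi> u) = \<bar>c\<bar> * nrm (dual E) \<phi>"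
    if \<phi>: "\<phi> \<in> pts (dual E)" for \<phi> c
  proof (cases "c = 0")
    case True
    then show ?thesis using le[OF \<phi>, of 0] dual_nrm_nonneg[OF 0] by simp
  next
    case False
    have "nrm (dual E) (\<lambda>u. (1 / c) * (c * \<phi> u)) \<le> \<bar>1 / c\<bar> * nrm (dual E) (\<lambda>u. c * \<phi> u)"
      using lc[OF \<phi> \<phi>, of c 0] by (intro le) simp
    then have "\<bar>c\<bar> * nrm (dual E) \<phi> \<le> nrm (dual E) (\<lambda>u. c * \<phi> u)"
      using False by (simp add: field_simps)
    with le[OF \<phi>, of c] show ?thesis by simp
  qed
qed

lemma dual_definite:
  assumes "\<phi> \<in> pts (dual E)" "nrm (dual E) \<phi> = 0"
  shows "\<phi> = (\<lambda>u. 0)"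
  using dual_bound[OF assms(1)] dual_outside[OF assms(1)] assms(2) by force

lemma Metric_space_dual: "Metric_space (pts (dual E)) (fdist (dual E))"
proof -
  interpret D: seminormed_fspace "dual E" by (rule seminormed_dual)
  show ?thesis
  proof
    show "0 \<le> fdist (dual E) u v" for u v
      by (simp add: fdist_def D.nrm_nonneg D.diff_mem)
    show "fdist (dual E) u v = fdist (dual E) v u" for u v
      using D.nrm_scale[OF D.diff_mem[of u v], of "-1"] by (simp add: fdist_def)
    show "(fdist (dual E) u v = 0) = (u = v)"
      if "u \<in> pts (dual E)" "v \<in> pts (dual E)" for u v
    proof
      assume "fdist (dual E) u v = 0"
      then have "(\<lambda>i. u i - v i) = (\<lambda>i. 0)"
        using that by (intro dual_definite D.diff_mem) (auto simp: fdist_def)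
      then show "u = v" by (auto simp: fun_eq_iff)
    qed (use that D.nrm_zero in \<open>auto simp: fdist_def\<close>)
    show "fdist (dual E) u w \<le> fdist (dual E) u v + fdist (dual E) v w"
      if "u \<in> pts (dual E)" "v \<in> pts (dual E)" "w \<in> pts (dual E)" for u v w
      using D.nrm_add[OF D.diff_mem[of u v] D.diff_mem[of v w]] that by (simp add: fdist_def)
  qed
qed

lemma eval_embed_mem:
  assumes u: "u \<in> pts E"
  shows "eval_embed E u \<in> pts (dual (dual E))"
proof -
  interpret D: seminormed_fspace "dual E" by (rule seminormed_dual)
  show ?thesis
  proof (rule D.dual_memI[where c = "nrm E u"])
    show "\<bar>eval_embed E u \<phi>\<bar> \<le> nrm E u * nrm (dual E) \<phi>" if "\<phi> \<in> pts (dual E)" for \<phi>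
      using dual_bound[OF that u] that by (simp add: eval_embed_def mult.commute)
  qed (auto simp: eval_embed_def D.lincomb_mem)
qed

lemma eval_embed_lincomb:
  assumes "u \<in> pts E" "v \<in> pts E"
  shows "(\<lambda>\<phi>. a * eval_embed E u \<phi> + b * eval_embed E v \<phi>)
    = eval_embed E (\<lambda>i. a * u i + b * v i)"
  using assms by (auto simp: eval_embed_def dual_lincomb fun_eq_iff)

text \<open>
  The topological closure in the definition of the completion, restated through approximation in
  norm; the vector space operations are continuous in this form.
\<close>
lemma completion_iff:
  "z \<in> pts (completion E) \<longleftrightarrow> z \<in> pts (dual (dual E)) \<and>
    (\<forall>r>0. \<exists>u\<in>pts E. nrm (dual (dual E)) (\<lambda>i. z i - eval_embed E u i) < r)"
proof -
  interpret D: seminormed_fspace "dual E" by (rule seminormed_dual)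
  interpret Metric_space "pts (dual (dual E))" "fdist (dual (dual E))"
    by (rule D.Metric_space_dual)
  have "z \<in> pts (completion E) \<longleftrightarrow> z \<in> pts (dual (dual E)) \<and>
      (\<forall>r>0. \<exists>y\<in>eval_embed E ` pts E. y \<in> mball z r)"
    by (simp add: completion_def ftop_def metric_closure_of)
  also have "\<dots> \<longleftrightarrow> z \<in> pts (dual (dual E)) \<and>
      (\<forall>r>0. \<exists>u\<in>pts E. nrm (dual (dual E)) (\<lambda>i. z i - eval_embed E u i) < r)"
    by (auto simp: Defs.fdist_def eval_embed_mem cong: conj_cong bex_cong)
  finally show ?thesis .
qed

lemma eval_embed_completion: "u \<in> pts E \<Longrightarrow> eval_embed E u \<in> pts (completion E)"
proof -
  assume u: "u \<in> pts E"
  interpret D: seminormed_fspace "dual E" by (rule seminormed_dual)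
  interpret DD: seminormed_fspace "dual (dual E)" by (rule D.seminormed_dual)
  show ?thesis
    unfolding completion_iff using eval_embed_mem[OF u] u DD.nrm_zero
    by (auto intro!: bexI[of _ u])
qed

text \<open>
  Closedness under linear combinations is what allows functionals on the completion to be defined
  as evaluation maps extended by \<open>0\<close>.
\<close>
lemma seminormed_completion: "seminormed_fspace (completion E)"
proof -
  interpret D: seminormed_fspace "dual E" by (rule seminormed_dual)
  interpret DD: seminormed_fspace "dual (dual E)" by (rule D.seminormed_dual)
  have sub: "z \<in> pts (dual (dual E))" if "z \<in> pts (completion E)" for z
    using that completion_iff by blast
  have n: "nrm (completion E) = nrm (dual (dual E))"
    by (simp add: completion_def)
  show ?thesis
  proof
    show "(\<lambda>i. 0) \<in> pts (completion E)"
      using eval_embed_completion[OF zero_mem] eval_embed_lincomb[OF zero_mem zero_mem, of 0 0]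
      by simp
    show "(\<lambda>i. a * y i + b * z i) \<in> pts (completion E)"
      if y: "y \<in> pts (completion E)" and z: "z \<in> pts (completion E)" for y z a b
      unfolding completion_iff
    proof (intro conjI allI impI)
      show "(\<lambda>i. a * y i + b * z i) \<in> pts (dual (dual E))"
        using y z by (intro DD.lincomb_mem sub)
      fix r :: real assume r: "r > 0"
      \<comment> \<open>The summand \<open>1\<close> keeps the denominator positive when \<open>a = b = 0\<close>.\<close>
      define \<rho> where "\<rho> = r / (\<bar>a\<bar> + \<bar>b\<bar> + 1)"
      have \<rho>: "\<rho> > 0" using r by (simp add: \<rho>_def)
      obtain u v where u: "u \<in> pts E" "nrm (dual (dual E)) (\<lambda>i. y i - eval_embed E u i) < \<rho>"
        and v: "v \<in> pts E" "nrm (dual (dual E)) (\<lambda>i. z i - eval_embed E v i) < \<rho>"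
        using y z \<rho> unfolding completion_iff by meson
      have "nrm (dual (dual E)) (\<lambda>i. a * (y i - eval_embed E u i) + b * (z i - eval_embed E v i))
          \<le> \<bar>a\<bar> * nrm (dual (dual E)) (\<lambda>i. y i - eval_embed E u i)
            + \<bar>b\<bar> * nrm (dual (dual E)) (\<lambda>i. z i - eval_embed E v i)"
        using y z u v by (intro DD.nrm_lincomb DD.diff_mem sub eval_embed_mem)
      also have "\<dots> \<le> \<bar>a\<bar> * \<rho> + \<bar>b\<bar> * \<rho>"
        using u v by (intro add_mono mult_left_mono) auto
      also have "\<dots> < (\<bar>a\<bar> + \<bar>b\<bar> + 1) * \<rho>"
        using \<rho> by (simp add: algebra_simps)
      also have "\<dots> = r"
        unfolding \<rho>_def by (simp add: field_simps)
      finally have "nrm (dual (dual E))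
          (\<lambda>i. (a * y i + b * z i) - eval_embed E (\<lambda>j. a * u j + b * v j) i) < r"
        unfolding eval_embed_lincomb[OF u(1) v(1), symmetric] by (simp add: algebra_simps)
      then show "\<exists>w\<in>pts E. nrm (dual (dual E)) (\<lambda>i. (a * y i + b * z i) - eval_embed E w i) < r"
        using lincomb_mem[OF u(1) v(1)] by blast
    qed
  qed (use sub DD.nrm_nonneg DD.nrm_scale DD.nrm_add in \<open>auto simp: n\<close>)
qed

end

section \<open>Elementary tensors in the projective tensor product\<close>

locale seminormed_fspace_pair =
  E: seminormed_fspace E + F: seminormed_fspace F
  for E :: "'i fspace" and F :: "'j fspace"
begin

definition rep_cost :: "(('i \<Rightarrow> real) \<times> ('j \<Rightarrow> real)) list \<Rightarrow> real" where
  "rep_cost xys = (\<Sum>(x, y)\<leftarrow>xys. nrm E x * nrm F y)"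

lemma rep_cost_nonneg: "set xys \<subseteq> pts E \<times> pts F \<Longrightarrow> 0 \<le> rep_cost xys"
  unfolding rep_cost_def by (induction xys) (auto simp: E.nrm_nonneg F.nrm_nonneg)

lemma pi_nrm: "nrm (pi_tensor E F) u = (INF xys\<in>tensor_reps E F u. rep_cost xys)"
  by (simp add: pi_tensor_def rep_cost_def)

lemma pi_nrm_le: "xys \<in> tensor_reps E F u \<Longrightarrow> nrm (pi_tensor E F) u \<le> rep_cost xys"
  unfolding pi_nrm
  by (rule cINF_lower) (auto intro!: bdd_belowI2[where m = 0] rep_cost_nonneg simp: tensor_reps_def)

lemma pi_nrm_ge:
  assumes "u \<in> pts (pi_tensor E F)"
    and "\<And>xys. xys \<in> tensor_reps E F u \<Longrightarrow> c \<le> rep_cost xys"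
  shows "c \<le> nrm (pi_tensor E F) u"
  unfolding pi_nrm using assms by (intro cINF_greatest) (auto simp: pi_tensor_def)

lemma tensor_reps_append:
  assumes "xs \<in> tensor_reps E F u" "ys \<in> tensor_reps E F v"
  shows "xs @ ys \<in> tensor_reps E F (\<lambda>b. u b + v b)"
  using assms by (auto simp: tensor_reps_def)

lemma tensor_reps_scale:
  assumes "xs \<in> tensor_reps E F u"
  shows "map (\<lambda>(x, y). (\<lambda>i. c * x i, y)) xs \<in> tensor_reps E F (\<lambda>b. c * u b)"
    and "rep_cost (map (\<lambda>(x, y). (\<lambda>i. c * x i, y)) xs) = \<bar>c\<bar> * rep_cost xs"
proof -
  have sub: "set xs \<subseteq> pts E \<times> pts F" and u: "u = (\<lambda>b. \<Sum>(x, y)\<leftarrow>xs. alg_tensor E F x y b)"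
    using assms by (auto simp: tensor_reps_def)
  have at: "alg_tensor E F (\<lambda>i. c * x i) y b = c * alg_tensor E F x y b"
    if "x \<in> pts E" "y \<in> pts F" for x y b
  proof (cases "b \<in> bilinear_forms E F")
    case True
    then have "b (\<lambda>i. c * x i + 0 * x i) y = c * b x y + 0 * b x y"
      using that unfolding bilinear_forms_def by blast
    then show ?thesis using True by (simp add: alg_tensor_def)
  qed (simp add: alg_tensor_def)
  have "(\<Sum>(x, y)\<leftarrow>map (\<lambda>(x, y). (\<lambda>i. c * x i, y)) xs. alg_tensor E F x y b)
      = c * (\<Sum>(x, y)\<leftarrow>xs. alg_tensor E F x y b)" for b
    using sub by (induction xs) (auto simp: at algebra_simps)
  then show "map (\<lambda>(x, y). (\<lambda>i. c * x i, y)) xs \<in> tensor_reps E F (\<lambda>b. c * u b)"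
    using sub E.scale_mem by (auto simp: tensor_reps_def u)
  show "rep_cost (map (\<lambda>(x, y). (\<lambda>i. c * x i, y)) xs) = \<bar>c\<bar> * rep_cost xs"
    using sub unfolding rep_cost_def
    by (induction xs) (auto simp: E.nrm_scale algebra_simps)
qed

text \<open>
  Representations of \<open>u\<close> and \<open>v\<close> concatenate to one of \<open>u + v\<close>, and scaling the left factors
  gives one of \<open>c u\<close>; passing to the infimum over representations yields the seminorm laws.
\<close>
lemma seminormed_pi_tensor: "seminormed_fspace (pi_tensor E F)"
proof
  have pts: "u \<in> pts (pi_tensor E F) \<longleftrightarrow> (\<exists>xs. xs \<in> tensor_reps E F u)" for u
    by (auto simp: pi_tensor_def)
  have nil: "[] \<in> tensor_reps E F (\<lambda>b. 0)" by (simp add: tensor_reps_def)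
  then show 0: "(\<lambda>b. 0) \<in> pts (pi_tensor E F)" using pts by blast
  show nn: "0 \<le> nrm (pi_tensor E F) u" if "u \<in> pts (pi_tensor E F)" for u
    using that by (intro pi_nrm_ge rep_cost_nonneg) (auto simp: tensor_reps_def)
  have sc: "(\<lambda>b. c * u b) \<in> pts (pi_tensor E F)" if "u \<in> pts (pi_tensor E F)" for u c
    using that tensor_reps_scale(1) unfolding pts by blast
  have ad: "(\<lambda>b. u b + v b) \<in> pts (pi_tensor E F)"
    if "u \<in> pts (pi_tensor E F)" "v \<in> pts (pi_tensor E F)" for u v
    using that tensor_reps_append unfolding pts by blast
  show "(\<lambda>i. a * u i + b * v i) \<in> pts (pi_tensor E F)"
    if "u \<in> pts (pi_tensor E F)" "v \<in> pts (pi_tensor E F)" for u v a b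
    using that by (intro ad sc)
  show "nrm (pi_tensor E F) (\<lambda>b. u b + v b) \<le> nrm (pi_tensor E F) u + nrm (pi_tensor E F) v"
    if u: "u \<in> pts (pi_tensor E F)" and v: "v \<in> pts (pi_tensor E F)" for u v
  proof -
    have *: "nrm (pi_tensor E F) (\<lambda>b. u b + v b) \<le> rep_cost xs + rep_cost ys"
      if "xs \<in> tensor_reps E F u" "ys \<in> tensor_reps E F v" for xs ys
      using pi_nrm_le[OF tensor_reps_append[OF that]] by (simp add: rep_cost_def)
    have "nrm (pi_tensor E F) (\<lambda>b. u b + v b) - rep_cost xs \<le> nrm (pi_tensor E F) v"
      if "xs \<in> tensor_reps E F u" for xs
      using *[OF that] by (intro pi_nrm_ge[OF v]) (simp add: algebra_simps)
    then have "nrm (pi_tensor E F) (\<lambda>b. u b + v b) - nrm (pi_tensor E F) v \<le> nrm (pi_tensor E F) u"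
      by (intro pi_nrm_ge[OF u]) (simp add: algebra_simps)
    then show ?thesis by simp
  qed
  have le: "nrm (pi_tensor E F) (\<lambda>b. c * u b) \<le> \<bar>c\<bar> * nrm (pi_tensor E F) u"
    if u: "u \<in> pts (pi_tensor E F)" and c: "c \<noteq> 0" for u c
  proof -
    have "nrm (pi_tensor E F) (\<lambda>b. c * u b) / \<bar>c\<bar> \<le> nrm (pi_tensor E F) u"
    proof (rule pi_nrm_ge[OF u])
      fix xs assume "xs \<in> tensor_reps E F u"
      from pi_nrm_le[OF tensor_reps_scale(1)[OF this]] tensor_reps_scale(2)[OF this]
      show "nrm (pi_tensor E F) (\<lambda>b. c * u b) / \<bar>c\<bar> \<le> rep_cost xs"
        using c by (simp add: field_simps)
    qed
    then show ?thesis using c by (simp add: field_simps)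
  qed
  show "nrm (pi_tensor E F) (\<lambda>b. c * u b) = \<bar>c\<bar> * nrm (pi_tensor E F) u"
    if u: "u \<in> pts (pi_tensor E F)" for u c
  proof (cases "c = 0")
    case True
    have "nrm (pi_tensor E F) (\<lambda>b. 0) = 0"
      using pi_nrm_le[OF nil] nn[OF 0] by (simp add: rep_cost_def)
    then show ?thesis using True by simp
  next
    case False
    have "nrm (pi_tensor E F) (\<lambda>b. (1 / c) * (c * u b))
        \<le> \<bar>1 / c\<bar> * nrm (pi_tensor E F) (\<lambda>b. c * u b)"
      using False by (intro le sc u) simp
    then have "\<bar>c\<bar> * nrm (pi_tensor E F) u \<le> nrm (pi_tensor E F) (\<lambda>b. c * u b)"
      using False by (simp add: field_simps)
    with le[OF u False] show ?thesis by simp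
  qed
qed

text \<open>
  The lower half of the cross-norm identity. The bilinear form \<open>b = f \<otimes> g\<close> is evaluated on a
  tensor \<open>u\<close> as \<open>u b\<close>, and the bound \<open>\<bar>u b\<bar> \<le> \<Sum> \<parallel>x\<^sub>i\<parallel> \<parallel>y\<^sub>i\<parallel>\<close> holds for each representation, hence
  for the infimum. So \<open>b\<close> induces a functional \<open>\<psi>\<close> of norm at most one on the algebraic tensor
  product. Evaluation at \<open>\<psi>\<close> is a functional \<open>\<Phi>\<close> of norm at most one on the completion, and
  \<open>\<Phi>\<close> maps \<open>x \<otimes> y\<close> to \<open>f x * g y\<close>.
\<close>
lemma nrm_tens_ge:
  assumes f: "f \<in> pts (dual E)" "\<And>u. u \<in> pts E \<Longrightarrow> \<bar>f u\<bar> \<le> nrm E u"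
    and g: "g \<in> pts (dual F)" "\<And>v. v \<in> pts F \<Longrightarrow> \<bar>g v\<bar> \<le> nrm F v"
    and x: "x \<in> pts E" and y: "y \<in> pts F"
  shows "\<bar>f x * g y\<bar> \<le> nrm (dual (dual (proj_tensor E F)))
    (eval_embed (proj_tensor E F) (tens E F x y))"
proof -
  define P where "P = pi_tensor E F"
  interpret P: seminormed_fspace P unfolding P_def by (rule seminormed_pi_tensor)
  interpret PD: seminormed_fspace "dual P" by (rule P.seminormed_dual)
  interpret Q: seminormed_fspace "completion P" by (rule P.seminormed_completion)
  interpret QD: seminormed_fspace "dual (completion P)" by (rule Q.seminormed_dual)
  define b where "b = (\<lambda>u v. f u * g v)"
  have b: "b \<in> bilinear_forms E F"
    using f(1) g(1) unfolding bilinear_forms_def b_def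
    by (auto simp: E.dual_lincomb F.dual_lincomb algebra_simps)
  have bb: "\<bar>u b\<bar> \<le> nrm P u" if u: "u \<in> pts P" for u
    unfolding P_def
  proof (rule pi_nrm_ge[OF that[unfolded P_def]])
    fix xs assume xs: "xs \<in> tensor_reps E F u"
    then have sub: "set xs \<subseteq> pts E \<times> pts F" and u: "u b = (\<Sum>(x, y)\<leftarrow>xs. f x * g y)"
      using b by (auto simp: tensor_reps_def alg_tensor_def b_def)
    show "\<bar>u b\<bar> \<le> rep_cost xs"
      unfolding u rep_cost_def using sub
    proof (induction xs)
      case (Cons p xs)
      obtain x y where p: "p = (x, y)" "x \<in> pts E" "y \<in> pts F" using Cons.prems by auto
      have "\<bar>f x * g y\<bar> \<le> nrm E x * nrm F y"
        unfolding abs_mult using p f(2) g(2) E.nrm_nonneg by (intro mult_mono) auto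
      then show ?case using Cons p by auto
    qed simp
  qed
  define \<psi> where "\<psi> = (\<lambda>u. if u \<in> pts P then u b else 0)"
  have \<psi>: "\<psi> \<in> pts (dual P)"
    by (rule P.dual_memI[where c = 1]) (auto simp: \<psi>_def P.lincomb_mem bb)
  have \<psi>1: "nrm (dual P) \<psi> \<le> 1"
    by (rule P.dual_nrm_le) (auto simp: \<psi>_def bb)
  define \<Phi> where "\<Phi> = (\<lambda>z. if z \<in> pts (completion P) then z \<psi> else 0)"
  have \<Phi>b: "\<bar>\<Phi> z\<bar> \<le> 1 * nrm (completion P) z" if z: "z \<in> pts (completion P)" for z
  proof -
    have z': "z \<in> pts (dual (dual P))" using z P.completion_iff by blast
    have "\<bar>z \<psi>\<bar> \<le> nrm (dual (dual P)) z * nrm (dual P) \<psi>"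
      by (rule PD.dual_bound[OF z' \<psi>])
    also have "\<dots> \<le> nrm (dual (dual P)) z * 1"
      using \<psi>1 PD.dual_nrm_nonneg[OF z'] by (rule mult_left_mono)
    finally show ?thesis using z by (simp add: \<Phi>_def completion_def)
  qed
  have \<Phi>: "\<Phi> \<in> pts (dual (completion P))"
    by (rule Q.dual_memI[OF _ \<Phi>b]) (auto simp: \<Phi>_def Q.lincomb_mem)
  have \<Phi>1: "nrm (dual (completion P)) \<Phi> \<le> 1"
    by (rule Q.dual_nrm_le[OF \<Phi>b]) auto
  have a: "alg_tensor E F x y \<in> pts P"
  proof -
    have "[(x, y)] \<in> tensor_reps E F (alg_tensor E F x y)"
      using x y by (simp add: tensor_reps_def)
    then show ?thesis unfolding P_def by (auto simp: pi_tensor_def)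
  qed
  define z where "z = tens E F x y"
  have zP: "z = eval_embed P (alg_tensor E F x y)" by (simp add: z_def tens_def P_def)
  have z: "z \<in> pts (completion P)"
    unfolding zP using a by (rule P.eval_embed_completion)
  have "f x * g y = eval_embed (completion P) z \<Phi>"
    using z \<Phi> \<psi> a b
    by (simp add: eval_embed_def \<Phi>_def zP) (simp add: \<psi>_def alg_tensor_def b_def)
  then have "\<bar>f x * g y\<bar>
      \<le> nrm (dual (dual (completion P))) (eval_embed (completion P) z) * nrm (dual (completion P)) \<Phi>"
    using QD.dual_bound[OF Q.eval_embed_mem[OF z] \<Phi>] by simp
  also have "\<dots> \<le> nrm (dual (dual (completion P))) (eval_embed (completion P) z) * 1"
    using \<Phi>1 QD.dual_nrm_nonneg[OF Q.eval_embed_mem[OF z]] by (rule mult_left_mono)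
  finally show ?thesis by (simp add: z_def proj_tensor_def P_def)
qed

end

section \<open>Point evaluations on spaces of continuous functions\<close>
lemma C_space_abs_le:
  assumes "u \<in> pts (C_space a b)" "x \<in> {a..b}"
  shows "\<bar>u x\<bar> \<le> nrm (C_space a b) u"
proof -
  have "continuous_on {a..b} (\<lambda>x. \<bar>u x\<bar>)"
    using assms(1) by (auto simp: C_space_def intro: continuous_intros)
  then have "bdd_above ((\<lambda>x. \<bar>u x\<bar>) ` {a..b})"
    by (intro bounded_imp_bdd_above compact_imp_bounded compact_continuous_image) auto
  then show ?thesis using assms(2) by (auto simp: C_space_def intro: cSUP_upper)
qed

lemma seminormed_C_space:
  assumes "a \<le> b"
  shows "seminormed_fspace (C_space a b)"
proof
  have ne: "{a..b} \<noteq> {}" using assms by simp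
  have le: "nrm (C_space a b) u \<le> c" if "\<And>x. x \<in> {a..b} \<Longrightarrow> \<bar>u x\<bar> \<le> c" for u c
    using that ne unfolding C_space_def by (auto intro: cSUP_least)
  show 0: "(\<lambda>i. 0) \<in> pts (C_space a b)" by (simp add: C_space_def)
  show "(\<lambda>i. c * u i + d * v i) \<in> pts (C_space a b)"
    if "u \<in> pts (C_space a b)" "v \<in> pts (C_space a b)" for u v c d
    using that by (auto simp: C_space_def intro!: continuous_intros)
  show "0 \<le> nrm (C_space a b) u" if "u \<in> pts (C_space a b)" for u
    using C_space_abs_le[OF that, of a] assms by force
  show "nrm (C_space a b) (\<lambda>i. u i + v i) \<le> nrm (C_space a b) u + nrm (C_space a b) v"
    if "u \<in> pts (C_space a b)" "v \<in> pts (C_space a b)" for u v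
    using C_space_abs_le[OF that(1)] C_space_abs_le[OF that(2)]
    by (intro le) (smt (verit))
  show "nrm (C_space a b) (\<lambda>i. c * u i) = \<bar>c\<bar> * nrm (C_space a b) u"
    if u: "u \<in> pts (C_space a b)" for u c
  proof (rule antisym)
    show "nrm (C_space a b) (\<lambda>i. c * u i) \<le> \<bar>c\<bar> * nrm (C_space a b) u"
      using C_space_abs_le[OF u] by (intro le) (simp add: abs_mult mult_left_mono)
    have cu: "(\<lambda>i. c * u i) \<in> pts (C_space a b)"
      using u by (auto simp: C_space_def intro!: continuous_intros)
    show "\<bar>c\<bar> * nrm (C_space a b) u \<le> nrm (C_space a b) (\<lambda>i. c * u i)"
    proof (cases "c = 0")
      case True
      then show ?thesis using C_space_abs_le[OF cu, of a] assms by force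
    next
      case False
      have "nrm (C_space a b) u \<le> nrm (C_space a b) (\<lambda>i. c * u i) / \<bar>c\<bar>"
        using C_space_abs_le[OF cu] False by (intro le) (simp add: abs_mult field_simps)
      then show ?thesis using False by (simp add: field_simps)
    qed
  qed
qed

text \<open>
  Point evaluation at \<open>x\<close> is a functional of norm at most one, so it can serve as both factors
  \<open>f\<close> and \<open>g\<close> in \<open>nrm_tens_ge\<close>.
\<close>
lemma nrm_tens_C_space_ge:
  assumes u: "u \<in> pts (C_space a b)" and x: "x \<in> {a..b}"
  shows "(u x)\<^sup>2 \<le> nrm (dual (dual (proj_tensor (C_space a b) (C_space a b))))
    (eval_embed (proj_tensor (C_space a b) (C_space a b)) (tens (C_space a b) (C_space a b) u u))"
proof -
  define f where "f = (\<lambda>u. if u \<in> pts (C_space a b) then u x else 0)"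
  have E: "seminormed_fspace (C_space a b)" using x by (intro seminormed_C_space) auto
  then interpret seminormed_fspace "C_space a b" .
  interpret seminormed_fspace_pair "C_space a b" "C_space a b" ..
  have f: "f \<in> pts (dual (C_space a b))"
    by (rule dual_memI[where c = 1]) (auto simp: f_def lincomb_mem C_space_abs_le[OF _ x])
  have "\<bar>f u * f u\<bar> \<le> nrm (dual (dual (proj_tensor (C_space a b) (C_space a b))))
    (eval_embed (proj_tensor (C_space a b) (C_space a b)) (tens (C_space a b) (C_space a b) u u))"
    by (rule nrm_tens_ge[OF f _ f _ u u]) (auto simp: f_def C_space_abs_le[OF _ x])
  then show ?thesis using u by (simp add: f_def power2_eq_square)
qed

section \<open>Brownian increments over a fixed interval\<close>

text \<open>
  The normal density is positive everywhere, in particular on the interval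
  \<open>[\<bar>K\<bar> + 1, \<bar>K\<bar> + 2]\<close>, where \<open>x\<^sup>2 > K\<close>.
\<close>
lemma std_normal_mass_less_1:
  "measure (density lborel (\<lambda>x. ennreal (std_normal_density x))) {x. x\<^sup>2 \<le> K} < 1"
proof (rule ccontr)
  define N where "N = density lborel (\<lambda>x. ennreal (std_normal_density x))"
  interpret N: prob_space N
    unfolding N_def by (rule prob_space_normal_density) simp
  have S: "{x. x\<^sup>2 \<le> K} \<in> sets N" by (simp add: N_def)
  assume "\<not> ?thesis"
  then have "measure N {x. x\<^sup>2 \<le> K} = 1"
    using N.prob_le_1 by (simp add: N_def not_less order_antisym)
  then have "AE x in N. x \<in> {x. x\<^sup>2 \<le> K}"
    by (rule N.AE_prob_1)
  then have "AE x in lborel. x\<^sup>2 \<le> K"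
    unfolding N_def by (subst (asm) AE_density) (auto simp: normal_density_pos)
  moreover have "\<not> x\<^sup>2 \<le> K" if x: "x \<in> {\<bar>K\<bar> + 1..\<bar>K\<bar> + 2}" for x
  proof -
    have "K < x" using x by auto
    also have "x * 1 \<le> x * x" using x by (intro mult_left_mono) auto
    finally show ?thesis by (simp add: power2_eq_square)
  qed
  ultimately have "AE x in lborel. x \<notin> {\<bar>K\<bar> + 1..\<bar>K\<bar> + 2}" by force
  then have "emeasure lborel {\<bar>K\<bar> + 1..\<bar>K\<bar> + 2} = 0"
    by (subst (asm) AE_iff_measurable[where N = "{\<bar>K\<bar> + 1..\<bar>K\<bar> + 2}"]) auto
  then show False by simp
qed

lemma brownian_increment_scaling:
  assumes bm: "brownian_motion M T W" and st: "0 \<le> s" "s < t" "t \<le> T"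
  shows "measure M ((\<lambda>\<omega>. W t \<omega> - W s \<omega>) -` {x. x\<^sup>2 \<le> K * (t - s)} \<inter> space M)
    = measure (density lborel (\<lambda>x. ennreal (std_normal_density x))) {x. x\<^sup>2 \<le> K}"
proof -
  interpret prob_space M using bm by (simp add: brownian_motion_def)
  have pos: "0 < sqrt (t - s)" using st by simp
  define X where "X = (\<lambda>\<omega>. (W t \<omega> - W s \<omega> - 0) / sqrt (t - s))"
  have X: "distributed M lborel X (\<lambda>x. ennreal (std_normal_density x))"
    unfolding X_def using bm st normal_standard_normal_convert[OF pos, of "\<lambda>\<omega>. W t \<omega> - W s \<omega>" 0]
    by (auto simp: brownian_motion_def)
  have "(X \<omega>)\<^sup>2 \<le> K \<longleftrightarrow> (W t \<omega> - W s \<omega>)\<^sup>2 \<le> K * (t - s)" for \<omega>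
    using st by (simp add: X_def power_divide pos_divide_le_eq)
  then have "(\<lambda>\<omega>. W t \<omega> - W s \<omega>) -` {x. x\<^sup>2 \<le> K * (t - s)} \<inter> space M
      = X -` {x. x\<^sup>2 \<le> K} \<inter> space M" by auto
  moreover have "measure M (X -` {x. x\<^sup>2 \<le> K} \<inter> space M)
      = measure (distr M lborel X) {x. x\<^sup>2 \<le> K}"
    using distributed_measurable[OF X] by (subst measure_distr) auto
  ultimately show ?thesis
    unfolding distributed_distr_eq_density[OF X] by simp
qed

text \<open>
  The exceptional event \<open>A\<close> says that all of the \<open>N\<close> consecutive increments of length \<open>\<epsilon>\<close> after
  time \<open>0\<close> are small. By independence and scaling its probability is \<open>p ^ N\<close>, for every \<open>\<epsilon>\<close>
  such that these increments fit into \<open>[0, a]\<close>. The conclusion is phrased with a measurable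
  \<open>A\<close> because the set of \<open>\<omega>\<close> without a large increment is an uncountable intersection.
\<close>
lemma brownian_increments_blow_up:
  assumes bm: "brownian_motion M T W" and a: "0 < a" "a \<le> T" and \<eta>: "0 < \<eta>"
  shows "\<forall>\<^sub>F \<epsilon> in at_right 0. \<exists>A\<in>sets M. measure M A < \<eta> \<and>
    (\<forall>\<omega>\<in>space M - A. \<exists>u\<in>{0..a}. u + \<epsilon> \<le> T \<and> K * \<epsilon> < (W (u + \<epsilon>) \<omega> - W u \<omega>)\<^sup>2)"
proof -
  interpret prob_space M using bm by (simp add: brownian_motion_def)
  define p where "p = measure (density lborel (\<lambda>x. ennreal (std_normal_density x))) {x. x\<^sup>2 \<le> K}"
  have p: "0 \<le> p" "p < 1" unfolding p_def using std_normal_mass_less_1 by auto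
  obtain n where n: "p ^ n < \<eta>" using real_arch_pow_inv[OF \<eta> p(2)] by blast
  define N where "N = Suc n"
  have N_pos: "0 < N" by (simp add: N_def)
  have N: "p ^ N < \<eta>"
  proof -
    have "p ^ N \<le> p ^ n" using p by (intro power_decreasing) (auto simp: N_def)
    with n show ?thesis by simp
  qed
  have "\<forall>\<^sub>F \<epsilon> in at_right 0. 0 < \<epsilon> \<and> \<epsilon> < a / N"
    using a by (intro eventually_at_rightI[of 0 "a / N"]) (auto simp: N_def)
  then show ?thesis
  proof eventually_elim
    case (elim \<epsilon>)
    have le: "real i * \<epsilon> \<le> a" if "i \<le> N" for i
    proof -
      have "real i * \<epsilon> \<le> real N * \<epsilon>" using that elim by (intro mult_right_mono) auto
      also have "\<dots> \<le> a" using elim by (simp add: N_def field_simps)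
      finally show ?thesis .
    qed
    define X where "X = (\<lambda>i \<omega>. W (real (Suc i) * \<epsilon>) \<omega> - W (real i * \<epsilon>) \<omega>)"
    have ind: "indep_vars (\<lambda>_. borel) X {..<N}"
    proof -
      have *: "\<forall>(n::nat) t. (\<forall>i\<le>n. t i \<in> {0..T}) \<and> (\<forall>i<n. t i < t (Suc i)) \<longrightarrow>
          indep_vars (\<lambda>_. borel) (\<lambda>i \<omega>. W (t (Suc i)) \<omega> - W (t i) \<omega>) {..<n}"
        using bm unfolding brownian_motion_def by (elim conjE)
      have "0 \<le> real i * \<epsilon> \<and> real i * \<epsilon> \<le> T" if "i \<le> N" for i
        using le[OF that] a elim by auto
      moreover have "real i * \<epsilon> < real (Suc i) * \<epsilon>" for i
        using elim by (intro mult_strict_right_mono) auto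
      ultimately show ?thesis
        unfolding X_def
        by (intro *[THEN spec[of _ N], THEN spec[of _ "\<lambda>i. real i * \<epsilon>"], THEN mp]) simp
    qed
    define A where "A = (\<Inter>i\<in>{..<N}. X i -` {x. x\<^sup>2 \<le> K * \<epsilon>} \<inter> space M)"
    have X_meas: "X i \<in> borel_measurable M" if "i < N" for i
      using ind that by (auto simp: indep_vars_def)
    have A: "A \<in> sets M"
      unfolding A_def
    proof (rule sets.finite_INT)
      fix i assume "i \<in> {..<N}"
      then show "X i -` {x. x\<^sup>2 \<le> K * \<epsilon>} \<inter> space M \<in> sets M"
        using X_meas by (intro measurable_sets[of _ _ borel]) auto
    qed (auto simp: N_def)
    have "prob A = (\<Prod>i<N. prob (X i -` {x. x\<^sup>2 \<le> K * \<epsilon>} \<inter> space M))"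
      unfolding A_def using ind by (intro indep_varsD_finite[of "\<lambda>_. borel"]) (auto simp: N_def)
    also have "\<dots> = (\<Prod>i<N. p)"
    proof (rule prod.cong[OF refl])
      fix i assume i: "i \<in> {..<N}"
      have "real (Suc i) * \<epsilon> - real i * \<epsilon> = \<epsilon>" by (simp add: algebra_simps)
      then show "prob (X i -` {x. x\<^sup>2 \<le> K * \<epsilon>} \<inter> space M) = p"
        using brownian_increment_scaling[OF bm, of "real i * \<epsilon>" "real (Suc i) * \<epsilon>" K]
          le[of "Suc i"] i a elim
        unfolding X_def p_def by (auto intro: order_trans)
    qed
    also have "\<dots> < \<eta>" using N by simp
    finally have "prob A < \<eta>" .
    moreover have "\<exists>u\<in>{0..a}. u + \<epsilon> \<le> T \<and> K * \<epsilon> < (W (u + \<epsilon>) \<omega> - W u \<omega>)\<^sup>2"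
      if \<omega>: "\<omega> \<in> space M - A" for \<omega>
    proof -
      obtain i where i: "i < N" "K * \<epsilon> < (X i \<omega>)\<^sup>2"
        using \<omega> N_pos by (auto simp: A_def not_le simp del: INT_simps)
      have "real (Suc i) * \<epsilon> = real i * \<epsilon> + \<epsilon>" by (simp add: algebra_simps)
      then show ?thesis
        using i le[of i] le[of "Suc i"] a elim
        by (intro bexI[of _ "real i * \<epsilon>"]) (auto simp: X_def)
    qed
    ultimately show ?case using A by blast
  qed
qed

section \<open>Increments of the window process\<close>

lemma continuous_on_ext_time:
  assumes "continuous_on {0..T} (\<lambda>t. W t \<omega>)" "0 \<le> T"
  shows "continuous_on UNIV (\<lambda>t. ext_time T W t \<omega>)"
  unfolding ext_time_def
  by (rule continuous_on_compose2[OF assms(1), of UNIV "\<lambda>t. max 0 (min T t)"])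
    (use assms(2) in \<open>auto intro!: continuous_intros\<close>)

lemma incr_window:
  "incr T (window T \<tau> W) \<epsilon> s \<omega> x = (if x \<in> {-\<tau>..0}
    then ext_time T W (max 0 (min T (s + \<epsilon>)) + x) \<omega> - ext_time T W (max 0 (min T s) + x) \<omega> else 0)"
  by (simp add: incr_def ext_time_def[of T "window T \<tau> W"] window_def)

lemma continuous_on_incr_window:
  assumes "continuous_on {0..T} (\<lambda>t. W t \<omega>)" "0 \<le> T"
  shows "continuous_on (S \<times> {-\<tau>..0}) (\<lambda>(s, x). incr T (window T \<tau> W) \<epsilon> s \<omega> x)"
proof -
  note c = continuous_on_compose2[OF continuous_on_ext_time[of T W \<omega>, OF assms]]
  have "continuous_on (S \<times> {-\<tau>..0}) (\<lambda>p. ext_time T W (max 0 (min T (fst p + \<epsilon>)) + snd p) \<omega>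
      - ext_time T W (max 0 (min T (fst p)) + snd p) \<omega>)"
    by (intro continuous_intros c) auto
  then show ?thesis
    by (rule continuous_on_eq) (auto simp: incr_window)
qed

lemma incr_window_mem:
  assumes "continuous_on {0..T} (\<lambda>t. W t \<omega>)" "0 \<le> T"
  shows "incr T (window T \<tau> W) \<epsilon> s \<omega> \<in> pts (C_space (-\<tau>) 0)"
proof -
  have "continuous_on {-\<tau>..0} (\<lambda>x. (\<lambda>(s, x). incr T (window T \<tau> W) \<epsilon> s \<omega> x) (s, x))"
    by (rule continuous_on_compose2[OF continuous_on_incr_window[of T W \<omega> UNIV, OF assms]])
      (auto intro!: continuous_intros)
  then show ?thesis by (simp add: C_space_def incr_window)
qed

text \<open>
  The point \<open>x = u - s\<close> of the window shows time \<open>u\<close> at \<open>s\<close> and time \<open>u + \<epsilon>\<close> at \<open>s + \<epsilon>\<close>. It lies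
  in \<open>[-\<tau>, 0]\<close> for all \<open>u\<close> in \<open>[0, \<tau>/2]\<close> at once as long as \<open>\<tau>/2 \<le> s \<le> \<tau>\<close>; the bound
  \<open>s \<le> \<tau> - \<epsilon>\<close> keeps \<open>s + \<epsilon>\<close> below \<open>T\<close>, where the constant extension of the process begins.
\<close>
lemma incr_window_contains_increment:
  assumes "\<tau> \<le> T" "0 < \<epsilon>" and s: "s \<in> {\<tau> / 2..\<tau> - \<epsilon>}" and u: "u \<in> {0..\<tau> / 2}" "u + \<epsilon> \<le> T"
  shows "u - s \<in> {-\<tau>..0}"
    and "incr T (window T \<tau> W) \<epsilon> s \<omega> (u - s) = W (u + \<epsilon>) \<omega> - W u \<omega>"
proof -
  show x: "u - s \<in> {-\<tau>..0}" using assms by auto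
  have "max 0 (min T (s + \<epsilon>)) = s + \<epsilon>" "max 0 (min T s) = s" using assms by auto
  then show "incr T (window T \<tau> W) \<epsilon> s \<omega> (u - s) = W (u + \<epsilon>) \<omega> - W u \<omega>"
    unfolding incr_window using x u assms by (simp add: ext_time_def add.commute)
qed

text \<open>
  This makes the sup norm of the window increments a continuous function of \<open>s\<close>, hence an
  integrable one. Without integrability the Lebesgue integral in the definition of the scalar
  quadratic variation would be \<open>0\<close> and would admit no lower bound.
\<close>
lemma continuous_on_SUP_abs:
  fixes h :: "'a::metric_space \<Rightarrow> 'b::metric_space \<Rightarrow> real"
  assumes h: "continuous_on (S \<times> K) (\<lambda>(s, x). h s x)"
    and S: "compact S" and K: "compact K" "K \<noteq> {}"
  shows "continuous_on S (\<lambda>s. SUP x\<in>K. \<bar>h s x\<bar>)"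
proof -
  have uc: "uniformly_continuous_on (S \<times> K) (\<lambda>(s, x). h s x)"
    using h S K by (intro compact_uniformly_continuous compact_Times)
  have bdd: "bdd_above ((\<lambda>x. \<bar>h s x\<bar>) ` K)" if "s \<in> S" for s
  proof -
    have "continuous_on K (\<lambda>x. (\<lambda>(s, x). h s x) (s, x))"
      by (rule continuous_on_compose2[OF h]) (use that in \<open>auto intro!: continuous_intros\<close>)
    then have "continuous_on K (\<lambda>x. \<bar>h s x\<bar>)" by (auto intro: continuous_intros)
    then show ?thesis
      using K by (intro bounded_imp_bdd_above compact_imp_bounded compact_continuous_image)
  qed
  show ?thesis
    unfolding continuous_on_iff
  proof (intro ballI allI impI)
    fix s and e :: real assume s: "s \<in> S" and e: "e > 0"
    obtain d where d: "d > 0" "\<And>p q. p \<in> S \<times> K \<Longrightarrow> q \<in> S \<times> K \<Longrightarrow> dist q p < d \<Longrightarrow>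
        dist ((\<lambda>(s, x). h s x) q) ((\<lambda>(s, x). h s x) p) < e / 2"
      using uc e unfolding uniformly_continuous_on_def by (meson half_gt_zero)
    have "\<bar>(SUP x\<in>K. \<bar>h r x\<bar>) - (SUP x\<in>K. \<bar>h s x\<bar>)\<bar> \<le> e / 2"
      if r: "r \<in> S" "dist r s < d" for r
    proof -
      have close: "\<bar>h r x - h s x\<bar> < e / 2" if "x \<in> K" for x
        using d(2)[of "(s, x)" "(r, x)"] r s that by (simp add: dist_Pair_Pair dist_real_def)
      have "(SUP x\<in>K. \<bar>h r x\<bar>) \<le> (SUP x\<in>K. \<bar>h s x\<bar>) + e / 2"
      proof (rule cSUP_least[OF K(2)])
        fix x assume x: "x \<in> K"
        have "\<bar>h s x\<bar> \<le> (SUP x\<in>K. \<bar>h s x\<bar>)" using x bdd[OF s] by (rule cSUP_upper)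
        then show "\<bar>h r x\<bar> \<le> (SUP x\<in>K. \<bar>h s x\<bar>) + e / 2" using close[OF x] by linarith
      qed
      moreover have "(SUP x\<in>K. \<bar>h s x\<bar>) \<le> (SUP x\<in>K. \<bar>h r x\<bar>) + e / 2"
      proof (rule cSUP_least[OF K(2)])
        fix x assume x: "x \<in> K"
        have "\<bar>h r x\<bar> \<le> (SUP x\<in>K. \<bar>h r x\<bar>)" using x bdd[OF r(1)] by (rule cSUP_upper)
        then show "\<bar>h s x\<bar> \<le> (SUP x\<in>K. \<bar>h r x\<bar>) + e / 2" using close[OF x] by linarith
      qed
      ultimately show ?thesis by linarith
    qed
    then show "\<exists>d>0. \<forall>r\<in>S. dist r s < d \<longrightarrow>
        dist (SUP x\<in>K. \<bar>h r x\<bar>) (SUP x\<in>K. \<bar>h s x\<bar>) < e"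
      using d(1) e by (intro exI[of _ d]) (force simp: dist_real_def)
  qed
qed

section \<open>Convergence in ucp\<close>

text \<open>By path continuity the supremum may be taken over a countable dense set of times.\<close>
lemma sets_SUP_abs_greater:
  fixes h :: "real \<Rightarrow> 'w \<Rightarrow> real"
  assumes T: "0 \<le> T"
    and meas: "\<And>t. t \<in> {0..T} \<Longrightarrow> h t \<in> borel_measurable M"
    and cont: "\<And>\<omega>. \<omega> \<in> space M \<Longrightarrow> continuous_on {0..T} (\<lambda>t. h t \<omega>)"
  shows "{\<omega> \<in> space M. (SUP t\<in>{0..T}. \<bar>h t \<omega>\<bar>) > \<delta>} \<in> sets M"
proof -
  obtain D where D: "countable D" "D \<subseteq> {0..T}" "{0..T} \<subseteq> closure D"
    using separable[of "{0..T}"] by metis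
  have "(SUP t\<in>{0..T}. \<bar>h t \<omega>\<bar>) > \<delta> \<longleftrightarrow> (\<exists>t\<in>D. \<bar>h t \<omega>\<bar> > \<delta>)" if \<omega>: "\<omega> \<in> space M" for \<omega>
  proof -
    have c: "continuous_on {0..T} (\<lambda>t. \<bar>h t \<omega>\<bar>)"
      using cont[OF \<omega>] by (rule continuous_on_rabs)
    then have "bdd_above ((\<lambda>t. \<bar>h t \<omega>\<bar>) ` {0..T})"
      by (intro bounded_imp_bdd_above compact_imp_bounded compact_continuous_image) auto
    then have "(SUP t\<in>{0..T}. \<bar>h t \<omega>\<bar>) > \<delta> \<longleftrightarrow> (\<exists>t\<in>{0..T}. \<bar>h t \<omega>\<bar> > \<delta>)"
      using T by (subst less_cSUP_iff) auto
    also have "\<dots> \<longleftrightarrow> (\<exists>t\<in>D. \<bar>h t \<omega>\<bar> > \<delta>)"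
    proof
      assume "\<exists>t\<in>{0..T}. \<bar>h t \<omega>\<bar> > \<delta>"
      then obtain t where t: "t \<in> {0..T}" "\<bar>h t \<omega>\<bar> > \<delta>" by blast
      obtain U where U: "open U" "U \<inter> {0..T} = (\<lambda>t. \<bar>h t \<omega>\<bar>) -` {\<delta><..} \<inter> {0..T}"
        using c open_greaterThan[of \<delta>] unfolding continuous_on_open_invariant by metis
      have "t \<in> U \<inter> {0..T}" unfolding U(2) using t by simp
      then have "t \<in> U" by simp
      moreover have "t \<in> closure D" using t(1) D(3) by blast
      ultimately obtain r where "r \<in> D" "r \<in> U"
        using U(1) open_Int_closure_eq_empty[of U D] by blast
      then have "r \<in> U \<inter> {0..T}" using D(2) by blast
      then have "\<bar>h r \<omega>\<bar> > \<delta>" unfolding U(2) by simp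
      then show "\<exists>t\<in>D. \<bar>h t \<omega>\<bar> > \<delta>" using \<open>r \<in> D\<close> by blast
    qed (use D(2) in blast)
    finally show ?thesis .
  qed
  then have "{\<omega> \<in> space M. (SUP t\<in>{0..T}. \<bar>h t \<omega>\<bar>) > \<delta>}
      = (\<Union>t\<in>D. {\<omega> \<in> space M. \<bar>h t \<omega>\<bar> > \<delta>})" by blast
  also have "\<dots> \<in> sets M"
  proof (rule sets.countable_UN'[OF D(1)], rule)
    fix A assume "A \<in> (\<lambda>t. {\<omega> \<in> space M. \<bar>h t \<omega>\<bar> > \<delta>}) ` D"
    then obtain t where t: "t \<in> D" and A: "A = {\<omega> \<in> space M. \<bar>h t \<omega>\<bar> > \<delta>}" by blast
    have [measurable]: "h t \<in> borel_measurable M" using t D(2) meas by blast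
    show "A \<in> sets M" unfolding A by measurable
  qed
  finally show ?thesis .
qed

text \<open>
  The inequality between the two probabilities depends on the larger event being measurable, as
  \<open>measure\<close> is \<open>0\<close> otherwise.
\<close>
lemma ucp_limit_imp_tendsto_in_prob:
  assumes M: "prob_space M" and ucp: "ucp_limit M T Y Z" and t: "t \<in> {0..T}" and \<delta>: "0 < \<delta>"
  shows "((\<lambda>\<epsilon>. measure M {\<omega> \<in> space M. \<bar>Y \<epsilon> t \<omega> - Z t \<omega>\<bar> > \<delta>}) \<longlongrightarrow> 0) (at_right 0)"
proof -
  interpret prob_space M by (rule M)
  have lim: "((\<lambda>\<epsilon>. measure M {\<omega> \<in> space M. (SUP t\<in>{0..T}. \<bar>Y \<epsilon> t \<omega> - Z t \<omega>\<bar>) > \<delta>}) \<longlongrightarrow> 0)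
      (at_right 0)"
    using ucp \<delta> by (simp add: ucp_limit_def)
  have Z: "Z \<in> cont_procs M T" using ucp by (simp add: ucp_limit_def)
  have "\<forall>\<^sub>F \<epsilon> in at_right 0. Y \<epsilon> \<in> cont_procs M T" using ucp by (simp add: ucp_limit_def)
  then have "\<forall>\<^sub>F \<epsilon> in at_right 0. measure M {\<omega> \<in> space M. \<bar>Y \<epsilon> t \<omega> - Z t \<omega>\<bar> > \<delta>}
      \<le> measure M {\<omega> \<in> space M. (SUP t\<in>{0..T}. \<bar>Y \<epsilon> t \<omega> - Z t \<omega>\<bar>) > \<delta>}"
  proof eventually_elim
    case (elim \<epsilon>)
    have c: "continuous_on {0..T} (\<lambda>t. Y \<epsilon> t \<omega> - Z t \<omega>)" if "\<omega> \<in> space M" for \<omega>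
      using elim Z that by (auto simp: cont_procs_def intro: continuous_intros)
    have m: "{\<omega> \<in> space M. (SUP t\<in>{0..T}. \<bar>Y \<epsilon> t \<omega> - Z t \<omega>\<bar>) > \<delta>} \<in> sets M"
      by (rule sets_SUP_abs_greater) (use c t elim Z in \<open>auto simp: cont_procs_def intro!: borel_measurable_diff\<close>)
    have "\<bar>Y \<epsilon> t \<omega> - Z t \<omega>\<bar> \<le> (SUP t\<in>{0..T}. \<bar>Y \<epsilon> t \<omega> - Z t \<omega>\<bar>)" if "\<omega> \<in> space M" for \<omega>
      using t continuous_on_rabs[OF c[OF that]]
      by (intro cSUP_upper bounded_imp_bdd_above compact_imp_bounded compact_continuous_image) auto
    then show ?case
      using m by (intro finite_measure_mono) fastforce+
  qed
  then show ?thesis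
    by (rule tendsto_sandwich[OF always_eventually _ tendsto_const lim, rotated]) simp
qed

lemma (in prob_space) exists_tail_prob_less:
  assumes [measurable]: "X \<in> borel_measurable M" and "0 < \<eta>"
  obtains C :: real where "prob {\<omega> \<in> space M. \<bar>X \<omega>\<bar> > C} < \<eta>"
proof -
  define A where "A = (\<lambda>n::nat. {\<omega> \<in> space M. \<bar>X \<omega>\<bar> > real n})"
  have "(\<lambda>n. prob (A n)) \<longlonglongrightarrow> prob (\<Inter>n. A n)"
    by (rule finite_Lim_measure_decseq) (auto simp: A_def decseq_def)
  moreover have "(\<Inter>n. A n) = {}"
  proof -
    have "\<exists>n. \<omega> \<notin> A n" for \<omega>
      using reals_Archimedean2[of "\<bar>X \<omega>\<bar>"] unfolding A_def by (metis (mono_tags, lifting) mem_Collect_eq not_less_iff_gr_or_eq)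
    then show ?thesis by blast
  qed
  ultimately have "\<forall>\<^sub>F n in sequentially. prob (A n) < \<eta>"
    using assms(2) by (intro order_tendstoD) auto
  then obtain n where "prob (A n) < \<eta>" by (auto simp: eventually_sequentially)
  then show ?thesis using that[of "real n"] by (simp add: A_def)
qed

section \<open>Blow-up of the quadratic variation\<close>

text \<open>
  The integrand is at least \<open>K\<close> on \<open>[\<tau>/2, \<tau> - \<epsilon>]\<close>, an interval of length at least \<open>\<tau>/4\<close> when
  \<open>\<epsilon> \<le> \<tau>/4\<close>.
\<close>
lemma scalar_qv_functional_ge:
  assumes \<tau>: "0 < \<tau>" "\<tau> \<le> T" and w: "continuous_on {0..T} (\<lambda>t. W t \<omega>)"
    and \<epsilon>: "0 < \<epsilon>" "\<epsilon> \<le> \<tau> / 4" and K: "0 \<le> K"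
    and u: "u \<in> {0..\<tau> / 2}" "u + \<epsilon> \<le> T" "K * \<epsilon> < (W (u + \<epsilon>) \<omega> - W u \<omega>)\<^sup>2"
  shows "\<tau> / 4 * K \<le>
    (LINT s:{0..T}|lborel. (nrm (C_space (-\<tau>) 0) (incr T (window T \<tau> W) \<epsilon> s \<omega>))\<^sup>2 / \<epsilon>)"
proof -
  define f where "f = (\<lambda>s. (nrm (C_space (-\<tau>) 0) (incr T (window T \<tau> W) \<epsilon> s \<omega>))\<^sup>2 / \<epsilon>)"
  have T: "0 \<le> T" using \<tau> by simp
  have "continuous_on {0..T} (\<lambda>s. SUP x\<in>{-\<tau>..0}. \<bar>incr T (window T \<tau> W) \<epsilon> s \<omega> x\<bar>)"
    using \<tau> by (intro continuous_on_SUP_abs continuous_on_incr_window[of T W \<omega>, OF w T]) auto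
  then have "continuous_on {0..T} f"
    using \<epsilon> unfolding f_def C_space_def by (auto intro!: continuous_intros)
  then have f: "set_integrable lborel {0..T} f"
    by (rule borel_integrable_atLeastAtMost')
  have f_ge: "K * indicator {\<tau> / 2..\<tau> - \<epsilon>} s \<le> f s" for s
  proof (cases "s \<in> {\<tau> / 2..\<tau> - \<epsilon>}")
    case True
    note x = incr_window_contains_increment[OF \<tau>(2) \<epsilon>(1) True u(1,2)]
    have "\<bar>W (u + \<epsilon>) \<omega> - W u \<omega>\<bar> \<le> nrm (C_space (-\<tau>) 0) (incr T (window T \<tau> W) \<epsilon> s \<omega>)"
      using C_space_abs_le[OF incr_window_mem[of T W \<omega> \<tau> \<epsilon> s, OF w T] x(1)] by (simp only: x(2))
    then have "(W (u + \<epsilon>) \<omega> - W u \<omega>)\<^sup>2 \<le> (nrm (C_space (-\<tau>) 0) (incr T (window T \<tau> W) \<epsilon> s \<omega>))\<^sup>2"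
      by (metis abs_ge_zero power2_abs power_mono)
    then have "K * \<epsilon> \<le> (nrm (C_space (-\<tau>) 0) (incr T (window T \<tau> W) \<epsilon> s \<omega>))\<^sup>2"
      using u(3) by linarith
    then show ?thesis using True \<epsilon> by (simp add: f_def pos_le_divide_eq)
  qed (use \<epsilon> in \<open>simp add: f_def\<close>)
  have sub: "{\<tau> / 2..\<tau> - \<epsilon>} \<subseteq> {0..T}" using \<tau> \<epsilon> by auto
  have "\<tau> / 4 * K \<le> K * (\<tau> - \<epsilon> - \<tau> / 2)"
  proof -
    have "K * (\<tau> / 4) \<le> K * (\<tau> - \<epsilon> - \<tau> / 2)" using K \<epsilon> by (intro mult_left_mono) auto
    then show ?thesis by (simp add: mult.commute)
  qed
  also have "\<dots> = (LINT s|lborel. K * indicator {\<tau> / 2..\<tau> - \<epsilon>} s)"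
    using \<epsilon> \<tau> by simp
  also have "\<dots> \<le> (LINT s:{0..T}|lborel. f s)"
    unfolding set_lebesgue_integral_def
  proof (rule integral_mono)
    show "integrable lborel (\<lambda>s. indicator {0..T} s *\<^sub>R f s)"
      using f by (simp add: set_integrable_def)
    show "integrable lborel (\<lambda>s. K * indicator {\<tau> / 2..\<tau> - \<epsilon>} s)"
      by (intro integrable_mult_right integrable_real_indicator) (auto simp: emeasure_lborel_Icc_eq)
    show "K * indicator {\<tau> / 2..\<tau> - \<epsilon>} s \<le> indicator {0..T} s *\<^sub>R f s" for s
      using f_ge[of s] sub by (auto simp: indicator_def split: if_splits)
  qed
  finally show ?thesis unfolding f_def .
qed

text \<open>
  The counterpart of \<open>scalar_qv_functional_ge\<close> for the integrals in H1. The lower bound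
  rests on monotonicity of the nonnegative integral, which is valid for nonmeasurable integrands too.
\<close>
lemma tensor_qv_functional_ge:
  assumes \<tau>: "0 < \<tau>" "\<tau> \<le> T" and w: "continuous_on {0..T} (\<lambda>t. W t \<omega>)"
    and \<epsilon>: "0 < \<epsilon>" "\<epsilon> \<le> \<tau> / 4" and K: "0 \<le> K"
    and u: "u \<in> {0..\<tau> / 2}" "u + \<epsilon> \<le> T" "K * \<epsilon> < (W (u + \<epsilon>) \<omega> - W u \<omega>)\<^sup>2"
    and B: "B = C_space (-\<tau>) 0" and X: "X = window T \<tau> W"
  shows "ennreal (\<tau> / 4 * K) \<le> (\<integral>\<^sup>+ s\<in>{0..T}.
      ennreal (nrm (dual (dual (proj_tensor B B)))
        (eval_embed (proj_tensor B B) (tens B B (incr T X \<epsilon> s \<omega>) (incr T X \<epsilon> s \<omega>))) / \<epsilon>) \<partial>lborel)"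
proof -
  define f where "f = (\<lambda>s. nrm (dual (dual (proj_tensor B B)))
        (eval_embed (proj_tensor B B) (tens B B (incr T X \<epsilon> s \<omega>) (incr T X \<epsilon> s \<omega>))) / \<epsilon>)"
  have T: "0 \<le> T" using \<tau> by simp
  have f_ge: "K \<le> f s" if s: "s \<in> {\<tau> / 2..\<tau> - \<epsilon>}" for s
  proof -
    note x = incr_window_contains_increment[OF \<tau>(2) \<epsilon>(1) s u(1,2)]
    have "K * \<epsilon> \<le> (incr T X \<epsilon> s \<omega> (u - s))\<^sup>2"
      using u(3) unfolding X x(2) by simp
    also have "\<dots> \<le> f s * \<epsilon>"
      using nrm_tens_C_space_ge[OF incr_window_mem[of T W \<omega>, OF w T] x(1)] \<epsilon>
      by (simp add: f_def B X)
    finally show ?thesis using \<epsilon> by simp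
  qed
  have sub: "{\<tau> / 2..\<tau> - \<epsilon>} \<subseteq> {0..T}" using \<tau> \<epsilon> by auto
  have "\<tau> / 4 * K \<le> K * (\<tau> - \<epsilon> - \<tau> / 2)"
  proof -
    have "K * (\<tau> / 4) \<le> K * (\<tau> - \<epsilon> - \<tau> / 2)" using K \<epsilon> by (intro mult_left_mono) auto
    then show ?thesis by (simp add: mult.commute)
  qed
  then have "ennreal (\<tau> / 4 * K) \<le> ennreal K * emeasure lborel {\<tau> / 2..\<tau> - \<epsilon>}"
    using \<epsilon> \<tau> K by (simp add: ennreal_mult[symmetric] ennreal_leI)
  also have "\<dots> = (\<integral>\<^sup>+ s. ennreal K * indicator {\<tau> / 2..\<tau> - \<epsilon>} s \<partial>lborel)"
    by (subst nn_integral_cmult_indicator) auto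
  also have "\<dots> \<le> (\<integral>\<^sup>+ s\<in>{0..T}. ennreal (f s) \<partial>lborel)"
    using f_ge sub by (intro nn_integral_mono) (auto simp: indicator_def intro: ennreal_leI)
  finally show ?thesis unfolding f_def .
qed

text \<open>
  For small \<open>\<epsilon>\<close> three events would cover the whole space: the limit exceeds \<open>C\<close>, the approximation
  is farther than \<open>1\<close> from the limit, or no increment is large. Each has probability below \<open>1/4\<close>.
\<close>
lemma window_not_scalar_qv:
  assumes \<tau>: "0 < \<tau>" "\<tau> \<le> T" and bm: "brownian_motion M T W"
  shows "\<not> admits_scalar_qv M T (C_space (-\<tau>) 0) (window T \<tau> W)"
proof
  interpret prob_space M using bm by (simp add: brownian_motion_def)
  define Y where "Y = (\<lambda>\<epsilon> t \<omega>. LINT s:{0..t}|lborel.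
    (nrm (C_space (-\<tau>) 0) (incr T (window T \<tau> W) \<epsilon> s \<omega>))\<^sup>2 / \<epsilon>)"
  assume "admits_scalar_qv M T (C_space (-\<tau>) 0) (window T \<tau> W)"
  then obtain Z where ucp: "ucp_limit M T Y Z" by (auto simp: admits_scalar_qv_def Y_def)
  have T: "T \<in> {0..T}" using \<tau> by simp
  have Z [measurable]: "Z T \<in> borel_measurable M"
    using ucp T by (simp add: ucp_limit_def cont_procs_def)
  obtain C where C: "prob {\<omega> \<in> space M. \<bar>Z T \<omega>\<bar> > C} < 1 / 4"
    by (rule exists_tail_prob_less[OF Z, of "1 / 4"]) simp
  \<comment> \<open>Large enough for \<open>\<tau> / 4 * K\<close> to exceed \<open>C + 1\<close>.\<close>
  define K where "K = 4 / \<tau> * (\<bar>C\<bar> + 2)"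
  have K: "0 \<le> K" "\<tau> / 4 * K = \<bar>C\<bar> + 2" using \<tau> by (auto simp: K_def)
  have "\<forall>\<^sub>F \<epsilon> in at_right 0. prob {\<omega> \<in> space M. \<bar>Y \<epsilon> T \<omega> - Z T \<omega>\<bar> > 1} < 1 / 4"
    by (rule order_tendstoD(2)[OF ucp_limit_imp_tendsto_in_prob[OF prob_space_axioms ucp T]]) auto
  moreover have "\<forall>\<^sub>F \<epsilon> in at_right 0. Y \<epsilon> \<in> cont_procs M T"
    using ucp by (simp add: ucp_limit_def)
  moreover have "\<forall>\<^sub>F \<epsilon> in at_right 0. \<exists>A\<in>sets M. prob A < 1 / 4 \<and>
      (\<forall>\<omega>\<in>space M - A. \<exists>u\<in>{0..\<tau> / 2}. u + \<epsilon> \<le> T \<and> K * \<epsilon> < (W (u + \<epsilon>) \<omega> - W u \<omega>)\<^sup>2)"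
    using \<tau> by (intro brownian_increments_blow_up[OF bm]) auto
  moreover have "\<forall>\<^sub>F \<epsilon> in at_right 0. 0 < \<epsilon> \<and> \<epsilon> \<le> \<tau> / 4"
    using \<tau> by (intro eventually_at_rightI[of 0 "\<tau> / 4"]) auto
  ultimately have "\<forall>\<^sub>F \<epsilon> in at_right (0::real). False"
  proof eventually_elim
    case (elim \<epsilon>)
    then obtain A where A: "A \<in> sets M" "prob A < 1 / 4"
      and u: "\<And>\<omega>. \<omega> \<in> space M - A \<Longrightarrow>
        \<exists>u\<in>{0..\<tau> / 2}. u + \<epsilon> \<le> T \<and> K * \<epsilon> < (W (u + \<epsilon>) \<omega> - W u \<omega>)\<^sup>2" by blast
    have [measurable]: "Y \<epsilon> T \<in> borel_measurable M"
      using elim T by (simp add: cont_procs_def)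
    define D where "D = {\<omega> \<in> space M. \<bar>Y \<epsilon> T \<omega> - Z T \<omega>\<bar> > 1}"
    define G where "G = {\<omega> \<in> space M. \<bar>Z T \<omega>\<bar> > C}"
    have [measurable]: "D \<in> sets M" "G \<in> sets M" by (auto simp: D_def G_def)
    have "\<omega> \<in> A \<union> D \<union> G" if \<omega>: "\<omega> \<in> space M" for \<omega>
    proof (rule ccontr)
      assume n: "\<omega> \<notin> A \<union> D \<union> G"
      have w: "continuous_on {0..T} (\<lambda>t. W t \<omega>)"
        using bm \<omega> by (simp add: brownian_motion_def)
      obtain v where v: "v \<in> {0..\<tau> / 2}" "v + \<epsilon> \<le> T" "K * \<epsilon> < (W (v + \<epsilon>) \<omega> - W v \<omega>)\<^sup>2"
        using u[of \<omega>] \<omega> n by blast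
      have "\<bar>C\<bar> + 2 \<le> Y \<epsilon> T \<omega>"
        using scalar_qv_functional_ge[of \<tau> T W \<omega> \<epsilon> K v, OF \<tau> w _ _ K(1) v] elim
        unfolding K(2) Y_def by simp
      then show False using n \<omega> by (auto simp: D_def G_def)
    qed
    then have "space M \<subseteq> A \<union> D \<union> G" by blast
    then have "1 \<le> prob (A \<union> D \<union> G)"
      using A by (subst prob_space[symmetric], intro finite_measure_mono) auto
    also have "\<dots> \<le> prob (A \<union> D) + prob G"
      using A by (intro measure_Un_le) auto
    also have "\<dots> \<le> prob A + prob D + prob G"
      using A by (intro add_right_mono measure_Un_le) auto
    also have "\<dots> < 1" using A C elim unfolding D_def G_def by linarith
    finally show False by simp
  qed
  then show False by (simp add: eventually_False)
qed

text \<open>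
  Along any subsequence the integrals exceed each given level almost surely at some index: the
  failure at an index has arbitrarily small probability, so failure at all indices has probability
  \<open>0\<close>. Letting the level run through the naturals makes the supremum infinite almost surely.
\<close>
lemma window_not_global_qv_H1:
  assumes \<tau>: "0 < \<tau>" "\<tau> \<le> T" and bm: "brownian_motion M T W"
  shows "\<not> global_qv_H1 M T (C_space (-\<tau>) 0) (window T \<tau> W)"
proof
  interpret prob_space M using bm by (simp add: brownian_motion_def)
  define B where "B = C_space (-\<tau>) 0"
  define X where "X = window T \<tau> W"
  define I where "I = (\<lambda>\<epsilon> \<omega>. \<integral>\<^sup>+ s\<in>{0..T}.
      ennreal (nrm (dual (dual (proj_tensor B B)))
        (eval_embed (proj_tensor B B) (tens B B (incr T X \<epsilon> s \<omega>) (incr T X \<epsilon> s \<omega>))) / \<epsilon>) \<partial>lborel)"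
  define \<epsilon> where "\<epsilon> = (\<lambda>n. \<tau> / 4 / real (Suc n))"
  have pos: "\<epsilon> n > 0" for n using \<tau> by (simp add: \<epsilon>_def)
  have dec: "decseq \<epsilon>"
    using \<tau> unfolding decseq_def \<epsilon>_def by (auto intro!: divide_left_mono)
  have lim: "\<epsilon> \<longlonglongrightarrow> 0"
    unfolding \<epsilon>_def by (rule LIMSEQ_Suc[OF lim_const_over_n])
  assume "global_qv_H1 M T (C_space (-\<tau>) 0) (window T \<tau> W)"
  then obtain r :: "nat \<Rightarrow> nat" where r: "strict_mono r"
    and fin: "AE \<omega> in M. (SUP k. I (\<epsilon> (r k)) \<omega>) < \<infinity>"
    unfolding global_qv_H1_def B_def[symmetric] X_def[symmetric] I_def
    using pos dec lim by blast
  have flim: "filterlim (\<lambda>k. \<epsilon> (r k)) (at_right 0) sequentially"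
    using LIMSEQ_subseq_LIMSEQ[OF lim r] pos pos[THEN less_imp_neq, THEN not_sym]
    by (auto simp: filterlim_at o_def)
  have small: "\<epsilon> n \<le> \<tau> / 4" for n
    using \<tau> by (simp add: \<epsilon>_def divide_le_eq)
  have big: "AE \<omega> in M. \<exists>k. ennreal (\<tau> / 4 * K) \<le> I (\<epsilon> (r k)) \<omega>" if K: "0 \<le> K" for K
  proof -
    have "\<exists>k. \<exists>A\<in>sets M. prob A < 1 / real (Suc j) \<and>
        (\<forall>\<omega>\<in>space M - A. \<exists>u\<in>{0..\<tau> / 2}. u + \<epsilon> (r k) \<le> T \<and>
          K * \<epsilon> (r k) < (W (u + \<epsilon> (r k)) \<omega> - W u \<omega>)\<^sup>2)" for j
    proof -
      have "\<forall>\<^sub>F \<epsilon> in at_right 0. \<exists>A\<in>sets M. prob A < 1 / real (Suc j) \<and>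
        (\<forall>\<omega>\<in>space M - A. \<exists>u\<in>{0..\<tau> / 2}. u + \<epsilon> \<le> T \<and> K * \<epsilon> < (W (u + \<epsilon>) \<omega> - W u \<omega>)\<^sup>2)"
        using \<tau> by (intro brownian_increments_blow_up[OF bm]) auto
      from eventually_happens'[OF _ eventually_compose_filterlim[OF this flim]]
      show ?thesis by simp
    qed
    then obtain k A where A: "\<And>j. A j \<in> sets M" "\<And>j. prob (A j) < 1 / real (Suc j)"
      and u: "\<And>j \<omega>. \<omega> \<in> space M - A j \<Longrightarrow> \<exists>u\<in>{0..\<tau> / 2}. u + \<epsilon> (r (k j)) \<le> T \<and>
          K * \<epsilon> (r (k j)) < (W (u + \<epsilon> (r (k j))) \<omega> - W u \<omega>)\<^sup>2" by metis
    show ?thesis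
    proof (rule AE_I')
      have le: "prob (\<Inter>j. A j) < 1 / real (Suc j)" for j
      proof -
        have "prob (\<Inter>j. A j) \<le> prob (A j)" using A by (intro finite_measure_mono) auto
        with A(2)[of j] show ?thesis by simp
      qed
      have "prob (\<Inter>j. A j) = 0"
      proof (rule ccontr)
        assume "prob (\<Inter>j. A j) \<noteq> 0"
        then have "0 < prob (\<Inter>j. A j)" by (simp add: less_le)
        from nat_approx_posE[OF this] le show False by (metis less_asym)
      qed
      then show "(\<Inter>j. A j) \<in> null_sets M"
        using A by (auto simp: null_sets_def emeasure_eq_measure)
      show "{\<omega> \<in> space M. \<not> (\<exists>k. ennreal (\<tau> / 4 * K) \<le> I (\<epsilon> (r k)) \<omega>)} \<subseteq> (\<Inter>j. A j)"
      proof (intro subsetI INT_I, rule ccontr)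
        fix \<omega> j
        assume \<omega>: "\<omega> \<in> {\<omega> \<in> space M. \<not> (\<exists>k. ennreal (\<tau> / 4 * K) \<le> I (\<epsilon> (r k)) \<omega>)}"
          and "\<omega> \<notin> A j"
        then obtain v where v: "v \<in> {0..\<tau> / 2}" "v + \<epsilon> (r (k j)) \<le> T"
            "K * \<epsilon> (r (k j)) < (W (v + \<epsilon> (r (k j))) \<omega> - W v \<omega>)\<^sup>2"
          using u[of \<omega> j] by blast
        have w: "continuous_on {0..T} (\<lambda>t. W t \<omega>)"
          using bm \<omega> by (simp add: brownian_motion_def)
        have "ennreal (\<tau> / 4 * K) \<le> I (\<epsilon> (r (k j))) \<omega>"
          unfolding I_def
          by (rule tensor_qv_functional_ge[of \<tau> T W \<omega>, OF \<tau> w pos small K v B_def X_def])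
        then show False using \<omega> by blast
      qed
    qed
  qed
  have "AE \<omega> in M. \<forall>n::nat. \<exists>k. ennreal (\<tau> / 4 * real n) \<le> I (\<epsilon> (r k)) \<omega>"
    unfolding AE_all_countable using big by simp
  with fin have "AE \<omega> in M. False"
  proof eventually_elim
    case (elim \<omega>)
    then obtain c where c: "(SUP k. I (\<epsilon> (r k)) \<omega>) = ennreal c" "0 \<le> c"
      by (cases "SUP k. I (\<epsilon> (r k)) \<omega>") auto
    obtain n where n: "c / (\<tau> / 4) < real n" using reals_Archimedean2 by blast
    obtain k where "ennreal (\<tau> / 4 * real n) \<le> I (\<epsilon> (r k)) \<omega>" using elim by blast
    also have "\<dots> \<le> ennreal c" unfolding c(1)[symmetric] by (rule SUP_upper) simp
    finally have "\<tau> / 4 * real n \<le> c" using c(2) by (simp add: ennreal_le_iff)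
    with n \<tau> show False by (simp add: field_simps)
  qed
  then show False by simp
qed

theorem proposition4p7:
  fixes M :: "'w measure" and T \<tau> :: real and W :: "real \<Rightarrow> 'w \<Rightarrow> real"
  assumes "0 < \<tau>" and "\<tau> \<le> T"
    and "brownian_motion M T W"
  shows "\<not> admits_scalar_qv M T (C_space (-\<tau>) 0) (window T \<tau> W)
       \<and> \<not> admits_global_qv M T (C_space (-\<tau>) 0) (window T \<tau> W)"
  using window_not_scalar_qv[OF assms] window_not_global_qv_H1[OF assms]
  by (simp add: admits_global_qv_def)

end
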